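(* Let $\mathcal{R}$ be a treeable, ergodic, discrete, probability-measure-preserving Borel equivalence relation on a standard Borel probability space $(X,\mu)$ with cost $>1$. Suppose there exists an ergodic, primitive, proper subequivalence relation $\mathcal{S}\le\mathcal{R}$. Then $\mathcal{R}$ is large; that is, for every countable group $G$ there exists an ergodic normal subequivalence relation $\mathcal{N}\le\mathcal{R}$ such that $\mathcal{R}/\mathcal{N}\cong G$.
   Context: "Countable" means countable or finite. Let $\mathcal{R}\subset X\times X$ be a Borel equivalence relation; $[x]_{\mathcal{R}}$ is the class of $x$. $\mathcal{R}$ is discrete if all classes are countable. Put $\mu_L(S)=\int |\{y:(x,y)\in S\}|\,d\mu(x)$ and $\mu_R(S)=\int |\{x:(x,y)\in S\}|\,d\mu(y)$ for Borel $S\subset\mathcal{R}$; $\mathcal{R}$ is probability-measure-preserving if $\mu_L=\mu_R$. $\mathcal{R}$ is ergodic if every measurable union of classes has measure $0$ or $1$. A subequivalence relation $\mathcal{S}\le\mathcal{R}$ is a Borel subset of $\mathcal{R}$ which is an equivalence relation on $X$; relations agreeing up to a $\mu_L$-null set are identified, and $\mathcal{S}$ is proper if it does not equal $\mathcal{R}$ a.e. A graphing of $\mathcal{R}$ is a symmetric Borel set $G\subset X\times X$ such that $\mathcal{R}$ is the smallest equivalence relation containing $G$. Its local graph at $x$ has vertex set $[x]_{\mathcal{R}}$ and edges $\{y,z\}$ with $y,z\in[x]_{\mathcal{R}}$ and $(y,z)\in G$. A treeing is a graphing all of whose local graphs are trees, and $\mathcal{R}$ is treeable if it has a treeing. The cost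 of $\mathcal{R}$ is the infimum of $\tfrac12\mu_L(G)$ over all graphings $G$ of $\mathcal{R}$. A subequivalence relation $\mathcal{S}\le\mathcal{R}$ is primitive if there are treeings $G_{\mathcal{S}}$ of $\mathcal{S}$ and $G_{\mathcal{R}}$ of $\mathcal{R}$ with $G_{\mathcal{S}}\subset G_{\mathcal{R}}$. A discrete Borel groupoid is a groupoid with a standard Borel structure, Borel structure maps, and countable source fibers. $\mathcal{R}$ is regarded as a groupoid with $(x,y)(y,z)=(x,z)$. A subequivalence relation $\mathcal{N}\le\mathcal{R}$ of an ergodic $\mathcal{R}$ is normal if (up to null sets) there are a discrete Borel groupoid $\mathcal{G}$ and a Borel homomorphism $c:\mathcal{R}\to\mathcal{G}$ with $\mathcal{N}=\operatorname{Ker}(c)=\{(x,y):c(x,y)\text{ is a unit}\}$ (equivalent to the definition of Feldman, Sutherland and Zimmer). If $\mathcal{N}$ is normal and ergodic, the quotient $\mathcal{R}/\mathcal{N}$ is the countable group $Q$, unique up to isomorphism, for which there is a Borel homomorphism $\theta:\mathcal{R}\to Q$ (so $\theta(x,y)\theta(y,z)=\theta(x,z)$) with $\operatorname{Ker}(\theta)=\mathcal{N}$ a.e. and such that for a.e. $x$ and every $h\in Q$ there is $y\in[x]_{\mathcal{R}}$ with $\theta(y,x)=h$. *)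

theory Defs
  imports "HOL-Probability.Probability" "HOL-Algebra.Algebra"
begin

definition standard_borel :: "'a measure \<Rightarrow> bool" where
  "standard_borel M \<longleftrightarrow>
     (\<exists>T. topspace T = space M \<and> completely_metrizable_space T \<and> second_countable T \<and>
          sets M = sigma_sets (space M) {U. openin T U})"

section \<open>Borel equivalence relations\<close>

text \<open>The class of \<open>x\<close> is \<open>R `` {x}\<close>, and the set of classes is \<open>space M // R\<close>.\<close>

definition borel_equiv :: "'a measure \<Rightarrow> 'a rel \<Rightarrow> bool" where
  "borel_equiv M R \<longleftrightarrow> R \<in> sets (M \<Otimes>\<^sub>M M) \<and> equiv (space M) R"

definition discrete_rel :: "'a measure \<Rightarrow> 'a rel \<Rightarrow> bool" where
  "discrete_rel M R \<longleftrightarrow> (\<forall>x \<in> space M. countable (R `` {x}))"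

text \<open>These are only used for Borel subsets of Borel equivalence relations with countable
  classes, where the integrands are Borel by the Lusin-Novikov theorem.\<close>

definition mu_L :: "'a measure \<Rightarrow> 'a rel \<Rightarrow> ennreal" where
  "mu_L M S = (\<integral>\<^sup>+ x. emeasure (count_space UNIV) {y. (x, y) \<in> S} \<partial>M)"

definition mu_R :: "'a measure \<Rightarrow> 'a rel \<Rightarrow> ennreal" where
  "mu_R M S = (\<integral>\<^sup>+ y. emeasure (count_space UNIV) {x. (x, y) \<in> S} \<partial>M)"

definition pmp :: "'a measure \<Rightarrow> 'a rel \<Rightarrow> bool" where
  "pmp M R \<longleftrightarrow> (\<forall>S \<in> sets (M \<Otimes>\<^sub>M M). S \<subseteq> R \<longrightarrow> mu_L M S = mu_R M S)"

definition ergodic_rel :: "'a measure \<Rightarrow> 'a rel \<Rightarrow> bool" where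
  "ergodic_rel M R \<longleftrightarrow>
     (\<forall>C. C \<subseteq> space M // R \<longrightarrow> \<Union>C \<in> sets M \<longrightarrow>
        emeasure M (\<Union>C) = 0 \<or> emeasure M (\<Union>C) = 1)"

definition rel_eq_ae :: "'a measure \<Rightarrow> 'a rel \<Rightarrow> 'a rel \<Rightarrow> bool" where
  "rel_eq_ae M S T \<longleftrightarrow> mu_L M ((S - T) \<union> (T - S)) = 0"

definition subrel :: "'a measure \<Rightarrow> 'a rel \<Rightarrow> 'a rel \<Rightarrow> bool" where
  "subrel M S R \<longleftrightarrow> S \<subseteq> R \<and> borel_equiv M S"

definition proper_subrel :: "'a measure \<Rightarrow> 'a rel \<Rightarrow> 'a rel \<Rightarrow> bool" where
  "proper_subrel M S R \<longleftrightarrow> subrel M S R \<and> \<not> rel_eq_ae M S R"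

section \<open>Graphings, treeings and cost\<close>

definition graphing :: "'a measure \<Rightarrow> 'a rel \<Rightarrow> 'a rel \<Rightarrow> bool" where
  "graphing M R G \<longleftrightarrow>
     G \<in> sets (M \<Otimes>\<^sub>M M) \<and> sym G \<and> G \<subseteq> R \<and>
     (\<forall>E. equiv (space M) E \<longrightarrow> G \<subseteq> E \<longrightarrow> R \<subseteq> E)"

definition local_edges :: "'a rel \<Rightarrow> 'a rel \<Rightarrow> 'a \<Rightarrow> 'a set set" where
  "local_edges R G x = {{y, z} | y z. y \<in> R `` {x} \<and> z \<in> R `` {x} \<and> (y, z) \<in> G}"

definition is_cycle :: "'a set set \<Rightarrow> 'a list \<Rightarrow> bool" where
  "is_cycle E vs \<longleftrightarrow>
     3 \<le> length vs \<and> distinct vs \<and>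
     (\<forall>i < length vs. {vs ! i, vs ! (Suc i mod length vs)} \<in> E)"

text \<open>Edges have two distinct endpoints, so a graph with a loop is not a tree.
  (\<open>Digraph_Component.tree\<close> does not apply to graphs with symmetric arcs, since there
  an arc followed by its reverse is a cycle.)\<close>

definition is_tree :: "'a set \<Rightarrow> 'a set set \<Rightarrow> bool" where
  "is_tree V E \<longleftrightarrow>
     V \<noteq> {} \<and>
     E \<subseteq> {{u, v} | u v. u \<in> V \<and> v \<in> V \<and> u \<noteq> v} \<and>
     (\<forall>u \<in> V. \<forall>v \<in> V. (u, v) \<in> {(a, b). {a, b} \<in> E}\<^sup>*) \<and>
     (\<nexists>vs. is_cycle E vs)"

definition treeing :: "'a measure \<Rightarrow> 'a rel \<Rightarrow> 'a rel \<Rightarrow> bool" where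
  "treeing M R G \<longleftrightarrow>
     graphing M R G \<and> (\<forall>x \<in> space M. is_tree (R `` {x}) (local_edges R G x))"

definition treeable :: "'a measure \<Rightarrow> 'a rel \<Rightarrow> bool" where
  "treeable M R \<longleftrightarrow> (\<exists>G. treeing M R G)"

definition cost :: "'a measure \<Rightarrow> 'a rel \<Rightarrow> ennreal" where
  "cost M R = (INF G \<in> {G. graphing M R G}. mu_L M G / 2)"

definition primitive_subrel :: "'a measure \<Rightarrow> 'a rel \<Rightarrow> 'a rel \<Rightarrow> bool" where
  "primitive_subrel M S R \<longleftrightarrow>
     subrel M S R \<and>
     (\<exists>G\<^sub>S G\<^sub>R. treeing M S G\<^sub>S \<and> treeing M R G\<^sub>R \<and> G\<^sub>S \<subseteq> G\<^sub>R)"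

section \<open>Discrete Borel groupoids, normal subrelations and quotients\<close>

text \<open>A groupoid is given by its space of arrows, units being identified with objects.
  The product \<open>mul G g h\<close> is meaningful when the source of \<open>g\<close> is the range of \<open>h\<close>, so that
  an equivalence relation with \<open>(x, y)(y, z) = (x, z)\<close> is a groupoid in which \<open>(x, y)\<close> has
  source \<open>y\<close> and range \<open>x\<close>.\<close>

record 'g groupoid_data =
  arrows :: "'g measure"
  src :: "'g \<Rightarrow> 'g"
  rng :: "'g \<Rightarrow> 'g"
  mul :: "'g \<Rightarrow> 'g \<Rightarrow> 'g"
  ginv :: "'g \<Rightarrow> 'g"

definition composable :: "'g groupoid_data \<Rightarrow> ('g \<times> 'g) set" where
  "composable G = {(g, h). g \<in> space (arrows G) \<and> h \<in> space (arrows G) \<and> src G g = rng G h}"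

definition units :: "'g groupoid_data \<Rightarrow> 'g set" where
  "units G = {u \<in> space (arrows G). src G u = u}"

locale discrete_borel_groupoid =
  fixes G :: "'g groupoid_data"
  assumes standard_borel_arrows: "standard_borel (arrows G)"
    and src_measurable: "src G \<in> arrows G \<rightarrow>\<^sub>M arrows G"
    and rng_measurable: "rng G \<in> arrows G \<rightarrow>\<^sub>M arrows G"
    and ginv_measurable: "ginv G \<in> arrows G \<rightarrow>\<^sub>M arrows G"
    and mul_measurable:
      "(\<lambda>(g, h). mul G g h) \<in>
         restrict_space (arrows G \<Otimes>\<^sub>M arrows G) (composable G) \<rightarrow>\<^sub>M arrows G"
    and src_rng_units:
      "g \<in> space (arrows G) \<Longrightarrow>
         src G (src G g) = src G g \<and> rng G (src G g) = src G g \<and>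
         src G (rng G g) = rng G g \<and> rng G (rng G g) = rng G g"
    and src_rng_mul:
      "(g, h) \<in> composable G \<Longrightarrow>
         src G (mul G g h) = src G h \<and> rng G (mul G g h) = rng G g"
    and mul_assoc:
      "(g, h) \<in> composable G \<Longrightarrow> (h, k) \<in> composable G \<Longrightarrow>
         mul G (mul G g h) k = mul G g (mul G h k)"
    and mul_units:
      "g \<in> space (arrows G) \<Longrightarrow> mul G (rng G g) g = g \<and> mul G g (src G g) = g"
    and src_rng_ginv:
      "g \<in> space (arrows G) \<Longrightarrow> src G (ginv G g) = rng G g \<and> rng G (ginv G g) = src G g"
    and mul_ginv:
      "g \<in> space (arrows G) \<Longrightarrow>
         mul G g (ginv G g) = rng G g \<and> mul G (ginv G g) g = src G g"
    and countable_source_fibers: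
      "u \<in> units G \<Longrightarrow> countable {g \<in> space (arrows G). src G g = u}"

definition borel_groupoid_hom ::
    "'a measure \<Rightarrow> 'a rel \<Rightarrow> 'g groupoid_data \<Rightarrow> ('a \<times> 'a \<Rightarrow> 'g) \<Rightarrow> bool" where
  "borel_groupoid_hom M R G c \<longleftrightarrow>
     c \<in> restrict_space (M \<Otimes>\<^sub>M M) R \<rightarrow>\<^sub>M arrows G \<and>
     (\<forall>x y z. (x, y) \<in> R \<longrightarrow> (y, z) \<in> R \<longrightarrow>
        (c (x, y), c (y, z)) \<in> composable G \<and> mul G (c (x, y)) (c (y, z)) = c (x, z))"

definition groupoid_ker :: "'a rel \<Rightarrow> 'g groupoid_data \<Rightarrow> ('a \<times> 'a \<Rightarrow> 'g) \<Rightarrow> 'a rel" where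
  "groupoid_ker R G c = {p \<in> R. c p \<in> units G}"

text \<open>Every standard Borel space is Borel isomorphic to one whose underlying set is a set of
  reals, so it is no restriction that the arrows of the groupoid are real numbers (with an
  arbitrary standard Borel structure).\<close>

definition normal_subrel :: "'a measure \<Rightarrow> 'a rel \<Rightarrow> 'a rel \<Rightarrow> bool" where
  "normal_subrel M N R \<longleftrightarrow>
     subrel M N R \<and>
     (\<exists>(G :: real groupoid_data) c.
        discrete_borel_groupoid G \<and> borel_groupoid_hom M R G c \<and>
        rel_eq_ae M N (groupoid_ker R G c))"

definition borel_group_hom ::
    "'a measure \<Rightarrow> 'a rel \<Rightarrow> ('g, 'm) monoid_scheme \<Rightarrow> ('a \<times> 'a \<Rightarrow> 'g) \<Rightarrow> bool" where
  "borel_group_hom M R Q \<theta> \<longleftrightarrow>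
     \<theta> \<in> restrict_space (M \<Otimes>\<^sub>M M) R \<rightarrow>\<^sub>M count_space (carrier Q) \<and>
     (\<forall>x y z. (x, y) \<in> R \<longrightarrow> (y, z) \<in> R \<longrightarrow>
        \<theta> (x, y) \<otimes>\<^bsub>Q\<^esub> \<theta> (y, z) = \<theta> (x, z))"

text \<open>\<open>Q\<close> is the quotient of \<open>R\<close> by \<open>N\<close>, which is determined up to isomorphism when \<open>N\<close> is
  normal and ergodic.\<close>

definition is_quotient ::
    "'a measure \<Rightarrow> 'a rel \<Rightarrow> 'a rel \<Rightarrow> ('g, 'm) monoid_scheme \<Rightarrow> bool" where
  "is_quotient M R N Q \<longleftrightarrow>
     group Q \<and> countable (carrier Q) \<and>
     (\<exists>\<theta>. borel_group_hom M R Q \<theta> \<and>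
          rel_eq_ae M {p \<in> R. \<theta> p = \<one>\<^bsub>Q\<^esub>} N \<and>
          (AE x in M. \<forall>h \<in> carrier Q. \<exists>y \<in> R `` {x}. \<theta> (y, x) = h))"

end

theory Submission
  imports Defs
begin

text \<open>Let \<open>E' \<subseteq> E\<close> be treeings of \<open>S\<close> and \<open>R\<close>. As \<open>E\<close> is a forest, weights in \<open>G\<close> on its edges, inverse to
  each other on reversed edges, multiply along paths to a cocycle \<open>\<theta>\<close> on \<open>R\<close>. Edges in \<open>S\<close> get weight
  one and the remaining edges, oriented in a Borel way, get the weight \<open>k x\<close> of their initial point
  \<open>x\<close>. Then the kernel of \<open>\<theta>\<close> contains \<open>S\<close> and is therefore ergodic. Because \<open>S\<close> is proper, the measure
  has no atoms and the initial points of the oriented edges outside \<open>S\<close> form a set of positive measure;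
  split it into infinitely many sets of positive measure and let \<open>k\<close> enumerate \<open>G\<close> on them. By
  ergodicity almost every point is \<open>S\<close>-related to each of these sets, so \<open>\<theta>\<close> attains every value.

  Instead of the Lusin-Novikov theorem, measurability rests on analytic sets: the sets where
  \<open>\<theta> = g\<close> are analytic and partition \<open>R\<close>, hence are Borel by Lusin's separation theorem, and the
  saturations occurring in the ergodicity argument are handled by an invariant version of that theorem
  together with the measurability of analytic sets.\<close>

section \<open>Analytic sets\<close>

text \<open>A weight depends only on the initial point of an oriented edge. Hence no edge is ever
  selected measurably: once a point lies in the set labelled g, every oriented edge outside
  \<open>S\<close> that starts there carries g. The price is that the set of available initial
  points is a projection. It is analytic and may fail to lie in \<open>sets M\<close>, since the
  measure is not assumed complete; positivity is therefore expressed through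
  \<open>outer_measure_of\<close> and then moved to a measurable subset of the same outer measure. A
  second obstacle is that \<open>ergodic_rel\<close> tests only measurable unions of classes,
  whereas the saturation of a Borel set is merely analytic. An invariant Borel set has to be
  interposed between that saturation and the saturation of whatever lies outside its measurable
  hull.\<close>

lemma open_baire_iff:
  fixes W :: "(nat \<Rightarrow> nat) set"
  shows "open W \<longleftrightarrow> (\<forall>\<sigma>\<in>W. \<exists>n. \<forall>\<tau>. (\<forall>i<n. \<tau> i = \<sigma> i) \<longrightarrow> \<tau> \<in> W)" (is "?L \<longleftrightarrow> ?R")
proof
  assume ?L
  show ?R
  proof
    fix \<sigma> assume "\<sigma> \<in> W"
    with \<open>?L\<close> obtain Y where Y: "\<sigma> \<in> Pi\<^sub>E UNIV Y" "\<And>i. openin euclidean (Y i)"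
       "finite {i. Y i \<noteq> topspace euclidean}" "Pi\<^sub>E UNIV Y \<subseteq> W"
      using product_topology_open_contains_basis[of "\<lambda>_. euclidean" UNIV W \<sigma>]
      unfolding open_fun_def by blast
    then obtain n where n: "\<forall>i\<in>{i. Y i \<noteq> UNIV}. i < n"
      by (auto simp: finite_nat_set_iff_bounded)
    have "\<tau> \<in> W" if "\<forall>i<n. \<tau> i = \<sigma> i" for \<tau>
    proof -
      have "\<tau> i \<in> Y i" for i
        using Y(1) that n by (cases "i < n") (auto simp: PiE_iff dest: spec[of _ i])
      then show ?thesis using Y(4) by auto
    qed
    then show "\<exists>n. \<forall>\<tau>. (\<forall>i<n. \<tau> i = \<sigma> i) \<longrightarrow> \<tau> \<in> W" by blast
  qed
next
  assume R: ?R
  have "\<exists>T. open T \<and> \<sigma> \<in> T \<and> T \<subseteq> W" if W: "\<sigma> \<in> W" for \<sigma>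
  proof -
    obtain n where n: "\<And>\<tau>. (\<forall>i<n. \<tau> i = \<sigma> i) \<Longrightarrow> \<tau> \<in> W" using bspec[OF R W] by metis
    have "open {\<tau>. \<forall>i\<in>{..<n}. \<tau> i \<in> {\<sigma> i}}"
      by (rule product_topology_basis'[where x = "\<lambda>i. i" and U = "\<lambda>i. {\<sigma> i}"])
        (simp, rule discrete_topology_class.open_discrete)
    then show ?thesis using n by (intro exI[of _ "{\<tau>. \<forall>i\<in>{..<n}. \<tau> i \<in> {\<sigma> i}}"]) auto
  qed
  then show ?L by (subst open_subopen) blast
qed

text \<open>One parameter sequence has to encode several others: by its even and odd positions, by
  its tail, or by the rows of a \<open>prod_encode\<close> array. Reading off any of them is an
  instance of this reindexing.\<close>

lemma continuous_on_reindex: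
  fixes p :: "'i \<Rightarrow> 'j"
  shows "continuous_on S (\<lambda>\<sigma> :: 'j \<Rightarrow> 'b :: topological_space. \<lambda>i. \<sigma> (p i))"
  by (rule continuous_on_coordinatewise_then_product)
    (rule continuous_on_subset[OF continuous_on_product_coordinates subset_UNIV])

lemma closed_vimage_reindex:
  fixes p :: "'i \<Rightarrow> 'j"
  shows "closed D \<Longrightarrow> closed {\<sigma> :: 'j \<Rightarrow> 'b :: topological_space. (\<lambda>i. \<sigma> (p i)) \<in> D}"
  using closed_vimage[OF _ continuous_on_reindex[of UNIV p]] by (simp add: vimage_def)

lemma continuous_map_baire:
  fixes D :: "(nat \<Rightarrow> nat) set"
  shows "continuous_map (top_of_set D) T \<psi> \<longleftrightarrow> \<psi> ` D \<subseteq> topspace T \<and>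
    (\<forall>\<sigma>\<in>D. \<forall>U. openin T U \<longrightarrow> \<psi> \<sigma> \<in> U \<longrightarrow> (\<exists>n. \<forall>\<tau>\<in>D. (\<forall>i<n. \<tau> i = \<sigma> i) \<longrightarrow> \<psi> \<tau> \<in> U))"
  (is "?L \<longleftrightarrow> ?R")
proof
  assume L: ?L
  have "\<exists>n. \<forall>\<tau>\<in>D. (\<forall>i<n. \<tau> i = \<sigma> i) \<longrightarrow> \<psi> \<tau> \<in> U" if "\<sigma> \<in> D" "openin T U" "\<psi> \<sigma> \<in> U" for \<sigma> U
  proof -
    have "openin (top_of_set D) {\<sigma> \<in> D. \<psi> \<sigma> \<in> U}"
      using L that(2) by (auto simp: continuous_map_def)
    then obtain W where "open W" "{\<sigma> \<in> D. \<psi> \<sigma> \<in> U} = D \<inter> W" by (auto simp: openin_open)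
    moreover from this that have "\<sigma> \<in> W" by blast
    ultimately obtain n where "\<And>\<tau>. \<forall>i<n. \<tau> i = \<sigma> i \<Longrightarrow> \<tau> \<in> W"
      unfolding open_baire_iff by metis
    with \<open>{\<sigma> \<in> D. \<psi> \<sigma> \<in> U} = D \<inter> W\<close> show ?thesis by (intro exI[of _ n]) blast
  qed
  with L show ?R by (auto simp: continuous_map_def)
next
  assume R: ?R
  have "openin (top_of_set D) {\<sigma> \<in> D. \<psi> \<sigma> \<in> U}" if "openin T U" for U
  proof -
    \<comment> \<open>These sequences have a prefix all of whose extensions in \<open>D\<close> are
      mapped into \<open>U\<close>. The set is open in the full sequence space and cuts out the
      preimage of \<open>U\<close> on \<open>D\<close>.\<close>
    have "open {\<sigma>. \<exists>n. \<forall>\<tau>\<in>D. (\<forall>i<n. \<tau> i = \<sigma> i) \<longrightarrow> \<psi> \<tau> \<in> U}"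
      unfolding open_baire_iff
    proof (clarify)
      fix \<sigma> n assume *: "\<forall>\<tau>\<in>D. (\<forall>i<n. \<tau> i = \<sigma> i) \<longrightarrow> \<psi> \<tau> \<in> U"
      show "\<exists>n. \<forall>\<tau>. (\<forall>i<n. \<tau> i = \<sigma> i) \<longrightarrow>
               \<tau> \<in> {\<sigma>. \<exists>n. \<forall>\<tau>\<in>D. (\<forall>i<n. \<tau> i = \<sigma> i) \<longrightarrow> \<psi> \<tau> \<in> U}"
        using * by (intro exI[of _ n] allI impI CollectI) simp
    qed
    moreover have "{\<sigma> \<in> D. \<psi> \<sigma> \<in> U} = D \<inter> {\<sigma>. \<exists>n. \<forall>\<tau>\<in>D. (\<forall>i<n. \<tau> i = \<sigma> i) \<longrightarrow> \<psi> \<tau> \<in> U}"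
      using R that by blast
    ultimately show ?thesis by (auto simp: openin_open)
  qed
  with R show ?L by (auto simp: continuous_map_def)
qed

section \<open>Closure properties of analytic sets\<close>

text \<open>Parametrising by closed subsets of Baire space instead of the whole space covers the
  empty set and lets closed constraints on parameters be imposed by intersection, without
  reparametrising.\<close>

definition analytic_in :: "'a topology \<Rightarrow> 'a set \<Rightarrow> bool" where
  "analytic_in T A \<longleftrightarrow> (\<exists>(D :: (nat \<Rightarrow> nat) set) \<psi>.
     closed D \<and> continuous_map (top_of_set D) T \<psi> \<and> A = \<psi> ` D)"

lemma analytic_inE:
  assumes "analytic_in T A"
  obtains D :: "(nat \<Rightarrow> nat) set" and \<psi>
  where "closed D" "continuous_map (top_of_set D) T \<psi>" "A = \<psi> ` D"
  using assms unfolding analytic_in_def by blast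

lemma analytic_in_subset_topspace: "analytic_in T A \<Longrightarrow> A \<subseteq> topspace T"
  unfolding analytic_in_def continuous_map_def by auto

lemma analytic_in_empty [simp]: "analytic_in T {}"
  unfolding analytic_in_def by (intro exI[of _ "{}"]) auto

lemma analytic_in_image:
  assumes "analytic_in T A" "continuous_map T T' f"
  shows "analytic_in T' (f ` A)"
  using assms unfolding analytic_in_def by (metis continuous_map_compose image_comp)

lemma analytic_in_Int_closedin:
  assumes "analytic_in T A" "closedin T C"
  shows "analytic_in T (A \<inter> C)"
proof -
  from assms(1) obtain D :: "(nat \<Rightarrow> nat) set" and \<psi>
    where D: "closed D" "continuous_map (top_of_set D) T \<psi>" "A = \<psi> ` D" by (rule analytic_inE)
  let ?D = "{\<sigma> \<in> D. \<psi> \<sigma> \<in> C}"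
  have "closedin (top_of_set D) ?D"
    using closedin_continuous_map_preimage[OF D(2) assms(2)] by simp
  then have "closed ?D" using D(1) closedin_closed_trans by blast
  moreover have "continuous_map (top_of_set ?D) T \<psi>"
    by (rule continuous_map_from_subtopology_mono[OF D(2)]) auto
  ultimately show ?thesis unfolding analytic_in_def using D(3)
    by (intro exI[of _ ?D] exI[of _ \<psi>]) auto
qed

text \<open>Interleaving: the even entries of a sequence parametrise \<open>A\<close>, the odd ones
  \<open>A'\<close>.\<close>

lemma analytic_in_Times:
  assumes "analytic_in T A" "analytic_in T' A'"
  shows "analytic_in (prod_topology T T') (A \<times> A')"
proof -
  from assms(1) obtain D :: "(nat \<Rightarrow> nat) set" and \<psi>
    where D: "closed D" "continuous_map (top_of_set D) T \<psi>" "A = \<psi> ` D" by (rule analytic_inE)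
  from assms(2) obtain D' :: "(nat \<Rightarrow> nat) set" and \<psi>'
    where D': "closed D'" "continuous_map (top_of_set D') T' \<psi>'" "A' = \<psi>' ` D'" by (rule analytic_inE)
  define p q where "p \<sigma> = (\<lambda>i. \<sigma> (2 * i))" and "q \<sigma> = (\<lambda>i. \<sigma> (2 * i + 1))" for \<sigma> :: "nat \<Rightarrow> nat"
  let ?D = "{\<sigma>. p \<sigma> \<in> D} \<inter> {\<sigma>. q \<sigma> \<in> D'}"
  let ?\<psi> = "\<lambda>\<sigma>. (\<psi> (p \<sigma>), \<psi>' (q \<sigma>))"
  have "closed ?D" unfolding p_def q_def by (intro closed_Int closed_vimage_reindex D D')
  moreover have "continuous_map (top_of_set ?D) (prod_topology T T') ?\<psi>"
    unfolding continuous_map_paired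
  proof
    have "continuous_map (top_of_set ?D) (top_of_set D) p"
      by (auto simp: continuous_map_in_subtopology p_def intro: continuous_on_reindex)
    from continuous_map_compose[OF this D(2)]
    show "continuous_map (top_of_set ?D) T (\<lambda>\<sigma>. \<psi> (p \<sigma>))" by (simp add: o_def)
    have "continuous_map (top_of_set ?D) (top_of_set D') q"
      by (auto simp: continuous_map_in_subtopology q_def intro: continuous_on_reindex)
    from continuous_map_compose[OF this D'(2)]
    show "continuous_map (top_of_set ?D) T' (\<lambda>\<sigma>. \<psi>' (q \<sigma>))" by (simp add: o_def)
  qed
  moreover have "A \<times> A' = ?\<psi> ` ?D"
  proof -
    have "(\<psi> \<sigma>, \<psi>' \<tau>) \<in> ?\<psi> ` ?D" if "\<sigma> \<in> D" "\<tau> \<in> D'" for \<sigma> \<tau>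
    proof -
      let ?\<rho> = "\<lambda>n. if even n then \<sigma> (n div 2) else \<tau> (n div 2)"
      have "p ?\<rho> = \<sigma>" "q ?\<rho> = \<tau>" by (auto simp: p_def q_def)
      then show ?thesis using that by (intro image_eqI[of _ _ ?\<rho>]) auto
    qed
    then show ?thesis unfolding D(3) D'(3) by auto
  qed
  ultimately show ?thesis unfolding analytic_in_def by blast
qed

text \<open>Entry 0 selects the set, and the remaining entries parametrise a point of it. The
  selecting entry lives in a discrete space, so it is constant near any given sequence and
  continuity is tested for one set at a time.\<close>

lemma analytic_in_UN:
  fixes A :: "nat \<Rightarrow> 'a set"
  assumes "\<And>i. analytic_in T (A i)"
  shows "analytic_in T (\<Union>i. A i)"
proof -
  have "\<exists>D \<psi>. closed (D :: (nat \<Rightarrow> nat) set) \<and> continuous_map (top_of_set D) T \<psi> \<and> A i = \<psi> ` D" for i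
    using assms unfolding analytic_in_def by blast
  then obtain D :: "nat \<Rightarrow> (nat \<Rightarrow> nat) set" and \<psi> where
    D: "\<And>i. closed (D i)" "\<And>i. continuous_map (top_of_set (D i)) T (\<psi> i)" "\<And>i. A i = \<psi> i ` D i"
    by metis
  define s where "s \<sigma> = (\<lambda>n. \<sigma> (Suc n))" for \<sigma> :: "nat \<Rightarrow> nat"
  let ?D = "{\<sigma>. s \<sigma> \<in> D (\<sigma> 0)}" and ?\<psi> = "\<lambda>\<sigma>. \<psi> (\<sigma> 0) (s \<sigma>)"
  have eq: "?D = (\<Inter>i. {\<sigma>. \<sigma> 0 \<in> - {i}} \<union> {\<sigma>. s \<sigma> \<in> D i})" by auto
  moreover have "closed {\<sigma> :: nat \<Rightarrow> nat. \<sigma> 0 \<in> - {i}}" for i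
  proof -
    have "closed ((\<lambda>\<sigma> :: nat \<Rightarrow> nat. \<sigma> 0) -` (- {i}))"
      by (intro closed_vimage continuous_on_product_coordinates) (unfold closed_def, rule discrete_topology_class.open_discrete)
    then show ?thesis by (simp add: vimage_def)
  qed
  moreover have "closed {\<sigma>. s \<sigma> \<in> D i}" for i
    unfolding s_def by (intro closed_vimage_reindex D)
  ultimately have "closed ?D" unfolding eq by (intro closed_INT ballI closed_Un) simp_all
  moreover have "continuous_map (top_of_set ?D) T ?\<psi>"
    unfolding continuous_map_baire
  proof (intro conjI ballI allI impI)
    have "\<psi> i ` D i \<subseteq> topspace T" for i
      using D(2)[of i] unfolding continuous_map_baire by (rule conjunct1)
    then show "?\<psi> ` ?D \<subseteq> topspace T" by (simp add: image_subset_iff)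
    fix \<sigma> U assume *: "\<sigma> \<in> ?D" "openin T U" "?\<psi> \<sigma> \<in> U"
    then obtain n where n: "\<And>\<tau>. \<tau> \<in> D (\<sigma> 0) \<Longrightarrow> \<forall>i<n. \<tau> i = s \<sigma> i \<Longrightarrow> \<psi> (\<sigma> 0) \<tau> \<in> U"
      using conjunct2[OF D(2)[of "\<sigma> 0", unfolded continuous_map_baire], rule_format, of "s \<sigma>" U] by auto
    \<comment> \<open>One entry more than the \<open>n\<close> found for the tail: entry 0 must
      agree too, so that both sequences are evaluated by the same map.\<close>
    show "\<exists>n. \<forall>\<tau>\<in>?D. (\<forall>i<n. \<tau> i = \<sigma> i) \<longrightarrow> \<psi> (\<tau> 0) (s \<tau>) \<in> U"
    proof (intro exI[of _ "Suc n"] ballI impI)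
      fix \<tau> assume \<tau>: "\<tau> \<in> ?D" "\<forall>i<Suc n. \<tau> i = \<sigma> i"
      then have "\<tau> 0 = \<sigma> 0" by auto
      then show "\<psi> (\<tau> 0) (s \<tau>) \<in> U" using n[of "s \<tau>"] \<tau> by (auto simp: s_def)
    qed
  qed
  moreover have "(\<Union>i. A i) = ?\<psi> ` ?D"
  proof -
    have "\<psi> i \<sigma> \<in> ?\<psi> ` ?D" if "\<sigma> \<in> D i" for i \<sigma>
      using that by (intro image_eqI[of _ _ "\<lambda>n. case n of 0 \<Rightarrow> i | Suc n \<Rightarrow> \<sigma> n"]) (auto simp: s_def)
    then show ?thesis unfolding D(3) by auto
  qed
  ultimately show ?thesis unfolding analytic_in_def by blast
qed

text \<open>A point of the intersection has a parameter for each set, and all of these are packed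
  into one sequence. That they lead to the same point is a closed condition because the space is
  Hausdorff.\<close>

lemma analytic_in_INT:
  fixes A :: "nat \<Rightarrow> 'a set"
  assumes "Hausdorff_space T" "\<And>i. analytic_in T (A i)"
  shows "analytic_in T (\<Inter>i. A i)"
proof -
  have "\<exists>D \<psi>. closed (D :: (nat \<Rightarrow> nat) set) \<and> continuous_map (top_of_set D) T \<psi> \<and> A i = \<psi> ` D" for i
    using assms unfolding analytic_in_def by blast
  then obtain D :: "nat \<Rightarrow> (nat \<Rightarrow> nat) set" and \<psi> where
    D: "\<And>i. closed (D i)" "\<And>i. continuous_map (top_of_set (D i)) T (\<psi> i)" "\<And>i. A i = \<psi> i ` D i"
    by metis
  define s where "s i \<sigma> = (\<lambda>n. \<sigma> (prod_encode (i, n)))" for i and \<sigma> :: "nat \<Rightarrow> nat"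
  let ?E = "{\<sigma>. \<forall>i. s i \<sigma> \<in> D i}"
  let ?D = "{\<sigma> \<in> ?E. \<forall>i. \<psi> i (s i \<sigma>) = \<psi> 0 (s 0 \<sigma>)}"
  have closed_E: "closed ?E" unfolding s_def by (intro closed_Collect_all closed_vimage_reindex D)
  have cont: "continuous_map (top_of_set ?E) T (\<lambda>\<sigma>. \<psi> i (s i \<sigma>))" for i
  proof -
    have "continuous_map (top_of_set ?E) (top_of_set (D i)) (s i)"
      by (auto simp: continuous_map_in_subtopology s_def intro: continuous_on_reindex)
    from continuous_map_compose[OF this D(2)] show ?thesis by (simp add: o_def)
  qed
  have eq: "?D = (\<Inter>i. {\<sigma> \<in> ?E. \<psi> i (s i \<sigma>) = \<psi> 0 (s 0 \<sigma>)})" by auto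
  have "closedin (top_of_set ?E) ?D"
    unfolding eq using closedin_continuous_maps_eq[OF assms(1) cont cont] by auto
  then have "closed ?D" using closed_E closedin_closed_trans by blast
  moreover have "continuous_map (top_of_set ?D) T (\<lambda>\<sigma>. \<psi> 0 (s 0 \<sigma>))"
    by (rule continuous_map_from_subtopology_mono[OF cont]) auto
  moreover have "(\<Inter>i. A i) = (\<lambda>\<sigma>. \<psi> 0 (s 0 \<sigma>)) ` ?D"
  proof (intro subset_antisym subsetI)
    show "x \<in> (\<lambda>\<sigma>. \<psi> 0 (s 0 \<sigma>)) ` ?D" if "x \<in> (\<Inter>i. A i)" for x
    proof -
      have "\<exists>\<sigma>\<in>D i. \<psi> i \<sigma> = x" for i using that unfolding D(3) by auto
      then obtain \<sigma> where \<sigma>: "\<And>i. \<sigma> i \<in> D i" "\<And>i. \<psi> i (\<sigma> i) = x" by metis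
      let ?\<rho> = "\<lambda>n. (case prod_decode n of (i, j) \<Rightarrow> \<sigma> i j)"
      have "s i ?\<rho> = \<sigma> i" for i by (auto simp: s_def)
      then show ?thesis using \<sigma> by (intro image_eqI[of _ _ ?\<rho>]) auto
    qed
    show "x \<in> (\<Inter>i. A i)" if x: "x \<in> (\<lambda>\<sigma>. \<psi> 0 (s 0 \<sigma>)) ` ?D" for x
    proof -
      obtain \<sigma> where "x = \<psi> 0 (s 0 \<sigma>)" "\<And>i. \<psi> i (s i \<sigma>) = \<psi> 0 (s 0 \<sigma>)" "\<And>i. s i \<sigma> \<in> D i"
        using x by auto
      then have "x = \<psi> i (s i \<sigma>)" "s i \<sigma> \<in> D i" for i by metis+
      then show ?thesis unfolding D(3) by blast
    qed
  qed
  ultimately show ?thesis unfolding analytic_in_def by blast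
qed

lemma analytic_in_Un:
  assumes "analytic_in T A" "analytic_in T B"
  shows "analytic_in T (A \<union> B)"
proof -
  have "A \<union> B = (\<Union>n::nat. if n = 0 then A else B)" by (auto split: if_splits)
  then show ?thesis using analytic_in_UN[of T "\<lambda>n. if n = 0 then A else B"] assms by auto
qed

lemma analytic_in_Int:
  assumes "Hausdorff_space T" "analytic_in T A" "analytic_in T B"
  shows "analytic_in T (A \<inter> B)"
proof -
  have "A \<inter> B = (\<Inter>n::nat. if n = 0 then A else B)" by (auto split: if_splits)
  then show ?thesis using analytic_in_INT[of T "\<lambda>n. if n = 0 then A else B"] assms by auto
qed

lemma analytic_in_countable_UN:
  assumes "countable I" "\<And>i. i \<in> I \<Longrightarrow> analytic_in T (A i)"
  shows "analytic_in T (\<Union>i\<in>I. A i)"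
proof (cases "I = {}")
  case False
  then have range: "range (from_nat_into I) = I" using assms(1) by (rule range_from_nat_into)
  then have "(\<Union>i\<in>I. A i) = (\<Union>n. A (from_nat_into I n))"
    by (metis image_image)
  then show ?thesis
    using analytic_in_UN[of T "\<lambda>n. A (from_nat_into I n)"] assms False
    by (simp add: from_nat_into)
qed auto

text \<open>The composition is the projection of a fibre product: in a Hausdorff space, equality of
  the two middle points is a closed condition on \<open>P \<times> Q\<close>.\<close>

lemma analytic_in_relcomp:
  assumes T: "Hausdorff_space T" and "analytic_in (prod_topology T T) P" "analytic_in (prod_topology T T) Q"
  shows "analytic_in (prod_topology T T) (P O Q)"
proof -
  let ?T2 = "prod_topology T T"
  let ?T4 = "prod_topology ?T2 ?T2"
  have c: "continuous_map ?T4 T (\<lambda>z. snd (fst z))" "continuous_map ?T4 T (\<lambda>z. fst (snd z))"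
     "continuous_map ?T4 T (\<lambda>z. fst (fst z))" "continuous_map ?T4 T (\<lambda>z. snd (snd z))"
    using continuous_map_compose[OF continuous_map_fst continuous_map_snd]
      continuous_map_compose[OF continuous_map_snd continuous_map_fst]
      continuous_map_compose[OF continuous_map_fst continuous_map_fst]
      continuous_map_compose[OF continuous_map_snd continuous_map_snd]
    by (auto simp: o_def)
  have "closedin ?T4 {z \<in> topspace ?T4. snd (fst z) = fst (snd z)}"
    by (intro closedin_continuous_maps_eq[OF T] c)
  then have "analytic_in ?T4 ((P \<times> Q) \<inter> {z \<in> topspace ?T4. snd (fst z) = fst (snd z)})"
    by (intro analytic_in_Int_closedin analytic_in_Times assms)
  then have "analytic_in ?T2 ((\<lambda>z. (fst (fst z), snd (snd z))) `
      ((P \<times> Q) \<inter> {z \<in> topspace ?T4. snd (fst z) = fst (snd z)}))"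
    by (rule analytic_in_image) (simp add: continuous_map_paired c)
  moreover have "(\<lambda>z. (fst (fst z), snd (snd z))) `
      ((P \<times> Q) \<inter> {z \<in> topspace ?T4. snd (fst z) = fst (snd z)}) = P O Q" (is "?I = _")
  proof
    show "?I \<subseteq> P O Q" by force
    show "P O Q \<subseteq> ?I"
    proof clarify
      fix x y z assume *: "(x, y) \<in> P" "(y, z) \<in> Q"
      then have "x \<in> topspace T \<and> y \<in> topspace T" "y \<in> topspace T \<and> z \<in> topspace T"
        using analytic_in_subset_topspace assms(2,3) by fastforce+
      with * show "(x, z) \<in> ?I"
        by (intro image_eqI[of _ _ "((x, y), (y, z))"]) auto
    qed
  qed
  ultimately show ?thesis by simp
qed

section \<open>Borel sets of Polish spaces are analytic\<close>

text \<open>A parameter lists indices into a dense sequence \<open>a\<close> such that consecutive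
  points have distance at most \<open>(1/2) ^ n\<close>. Completeness turns such a list into its
  limit, and density makes every point a limit.\<close>

lemma analytic_in_topspace:
  assumes "completely_metrizable_space T" "second_countable T"
  shows "analytic_in T (topspace T)"
proof (cases "topspace T = {}")
  case False
  obtain K d where K: "Metric_space K d" "Metric_space.mcomplete K d" "T = Metric_space.mtopology K d"
    using assms(1) unfolding completely_metrizable_space_def by blast
  interpret Metric_space K d by (rule K(1))
  have T: "T = mtopology" "topspace T = K" using K(3) by auto
  obtain C where C: "countable C" "C \<subseteq> K" "mtopology closure_of C = K"
    using second_countable_imp_separable_space[OF assms(2)] unfolding separable_space_def T(1) by auto
  have "C \<noteq> {}" using C(3) False T by auto
  define a where "a = from_nat_into C"
  have a: "a n \<in> K" for n using C(2) from_nat_into[OF \<open>C \<noteq> {}\<close>, of n] by (auto simp: a_def)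
  have dense: "\<exists>n. d (a n) x < \<epsilon>" if x: "x \<in> K" and \<epsilon>: "\<epsilon> > 0" for x \<epsilon>
  proof -
    from x have "x \<in> mtopology closure_of C" using C(3) by simp
    then obtain y where "y \<in> C" "d x y < \<epsilon>"
      using \<epsilon> unfolding metric_closure_of by auto
    moreover obtain n where "a n = y"
      using from_nat_into_surj[OF C(1) \<open>y \<in> C\<close>] by (auto simp: a_def)
    ultimately show ?thesis by (metis commute)
  qed
  define \<delta> :: "nat \<Rightarrow> real" where "\<delta> n = (1/2) ^ n" for n
  have \<delta>_pos: "\<delta> n > 0" and \<delta>_Suc: "\<delta> (Suc n) = \<delta> n / 2" for n by (auto simp: \<delta>_def)
  have \<delta>_lim: "\<exists>n. \<delta> n < \<epsilon>" if "\<epsilon> > 0" for \<epsilon>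
    using real_arch_pow_inv[OF that, of "1/2"] by (auto simp: \<delta>_def)
  define D where "D = {\<sigma>. \<forall>n. d (a (\<sigma> n)) (a (\<sigma> (Suc n))) \<le> \<delta> n}"
  have "closed D"
  proof -
    have "open (- D)" unfolding open_baire_iff
    proof
      fix \<sigma> assume "\<sigma> \<in> - D"
      then obtain n where n: "\<not> d (a (\<sigma> n)) (a (\<sigma> (Suc n))) \<le> \<delta> n" by (auto simp: D_def)
      have "\<tau> \<in> - D" if "\<forall>i<Suc (Suc n). \<tau> i = \<sigma> i" for \<tau>
      proof -
        have "\<tau> n = \<sigma> n" "\<tau> (Suc n) = \<sigma> (Suc n)" using that by simp_all
        then have "\<not> d (a (\<tau> n)) (a (\<tau> (Suc n))) \<le> \<delta> n" using n by simp
        then show ?thesis unfolding D_def by blast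
      qed
      then show "\<exists>n. \<forall>\<tau>. (\<forall>i<n. \<tau> i = \<sigma> i) \<longrightarrow> \<tau> \<in> - D" by metis
    qed
    then show ?thesis by (simp only: closed_open)
  qed
  \<comment> \<open>The right-hand side is the geometric sum of \<open>\<delta>\<close> from
    \<open>n\<close> up to \<open>n + k - 1\<close>, written so that the induction
    telescopes.\<close>
  have dist: "d (a (\<sigma> n)) (a (\<sigma> (n + k))) \<le> 2 * \<delta> n - 2 * \<delta> (n + k)" if "\<sigma> \<in> D" for \<sigma> n k
  proof (induction k)
    case (Suc k)
    have "d (a (\<sigma> (n + k))) (a (\<sigma> (Suc (n + k)))) \<le> \<delta> (n + k)" using that by (auto simp: D_def)
    with Suc triangle[OF a a a, of "\<sigma> n" "\<sigma> (Suc (n + k))" "\<sigma> (n + k)"] show ?case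
      using \<delta>_Suc[of "n + k"] by simp
  qed (use a in auto)
  have lim: "\<exists>x\<in>K. \<forall>n. d (a (\<sigma> n)) x \<le> 2 * \<delta> n" if "\<sigma> \<in> D" for \<sigma>
  proof -
    have le: "d (a (\<sigma> n)) (a (\<sigma> m)) < \<epsilon>" if "N \<le> n" "n \<le> m" "2 * \<delta> N < \<epsilon>" for n m N \<epsilon>
    proof -
      have "\<delta> n \<le> \<delta> N" using that unfolding \<delta>_def by (intro power_decreasing) auto
      moreover have "d (a (\<sigma> n)) (a (\<sigma> m)) \<le> 2 * \<delta> n - 2 * \<delta> m"
        using dist[OF \<open>\<sigma> \<in> D\<close>, of n "m - n"] that by simp
      ultimately show ?thesis using \<delta>_pos[of m] that by linarith
    qed
    have "MCauchy (\<lambda>n. a (\<sigma> n))"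
      unfolding MCauchy_def
    proof (intro conjI allI impI)
      fix \<epsilon> :: real assume "\<epsilon> > 0"
      then obtain N where "\<delta> N < \<epsilon> / 2" using \<delta>_lim[of "\<epsilon> / 2"] by auto
      then have N: "2 * \<delta> N < \<epsilon>" by simp
      have "d (a (\<sigma> n)) (a (\<sigma> m)) < \<epsilon>" if "N \<le> n" "N \<le> m" for n m
        using le[OF that(1) _ N, of m] le[OF that(2) _ N, of n] commute by (cases "n \<le> m") auto
      then show "\<exists>N. \<forall>n n'. N \<le> n \<longrightarrow> N \<le> n' \<longrightarrow> d (a (\<sigma> n)) (a (\<sigma> n')) < \<epsilon>" by blast
    qed (use a in auto)
    then obtain x where x: "limitin mtopology (\<lambda>n. a (\<sigma> n)) x sequentially"
      using K(2) unfolding mcomplete_def by blast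
    have "d (a (\<sigma> n)) x \<le> 2 * \<delta> n" for n
    proof (rule field_le_epsilon)
      fix \<epsilon> :: real assume "\<epsilon> > 0"
      then obtain N where N: "\<And>m. m \<ge> N \<Longrightarrow> d (a (\<sigma> m)) x < \<epsilon>"
        using x unfolding limit_metric_sequentially by blast
      have "d (a (\<sigma> n)) (a (\<sigma> (n + N))) \<le> 2 * \<delta> n"
        using dist[OF \<open>\<sigma> \<in> D\<close>, of n N] \<delta>_pos[of "n + N"] by simp
      moreover have "d (a (\<sigma> (n + N))) x < \<epsilon>" using N by simp
      moreover have "x \<in> K" using x unfolding limit_metric_sequentially by blast
      ultimately show "d (a (\<sigma> n)) x \<le> 2 * \<delta> n + \<epsilon>"
        using triangle[OF a a, of x "\<sigma> n" "\<sigma> (n + N)"] by linarith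
    qed
    then show ?thesis using x unfolding limit_metric_sequentially by blast
  qed
  then obtain \<psi> where \<psi>: "\<And>\<sigma>. \<sigma> \<in> D \<Longrightarrow> \<psi> \<sigma> \<in> K" "\<And>\<sigma> n. \<sigma> \<in> D \<Longrightarrow> d (a (\<sigma> n)) (\<psi> \<sigma>) \<le> 2 * \<delta> n"
    by metis
  have "continuous_map (top_of_set D) T \<psi>"
    unfolding continuous_map_baire
  proof (intro conjI ballI allI impI)
    show "\<psi> ` D \<subseteq> topspace T" using \<psi>(1) T by auto
    fix \<sigma> U assume *: "\<sigma> \<in> D" "openin T U" "\<psi> \<sigma> \<in> U"
    then obtain r where r: "r > 0" "mball (\<psi> \<sigma>) r \<subseteq> U" unfolding T(1) openin_mtopology by blast
    obtain n where n: "\<delta> n < r / 4" using \<delta>_lim[of "r / 4"] r by auto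
    \<comment> \<open>Agreement up to and including entry \<open>n\<close> gives both limits the
      common approximant \<open>a (\<sigma> n)\<close>, at distance at most
      \<open>2 * \<delta> n\<close> from each; hence the requirement
      \<open>\<delta> n < r / 4\<close>.\<close>
    have "\<psi> \<tau> \<in> U" if "\<tau> \<in> D" "\<forall>i<Suc n. \<tau> i = \<sigma> i" for \<tau>
    proof -
      have "d (a (\<sigma> n)) (\<psi> \<tau>) \<le> 2 * \<delta> n" using \<psi>(2)[OF that(1), of n] that(2) by simp
      then have "d (\<psi> \<sigma>) (\<psi> \<tau>) < r"
        using \<psi>(2)[OF *(1), of n] triangle[OF \<psi>(1)[OF *(1)] a[of "\<sigma> n"] \<psi>(1)[OF that(1)]] n
          commute[of "\<psi> \<sigma>" "a (\<sigma> n)"] by linarith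
      then show ?thesis using r(2) \<psi>(1) * that(1) by auto
    qed
    then show "\<exists>n. \<forall>\<tau>\<in>D. (\<forall>i<n. \<tau> i = \<sigma> i) \<longrightarrow> \<psi> \<tau> \<in> U" by blast
  qed
  moreover have "topspace T = \<psi> ` D"
  proof (intro subset_antisym subsetI)
    fix x assume "x \<in> topspace T"
    then have x: "x \<in> K" using T by simp
    \<comment> \<open>Precision \<open>\<delta> n / 2\<close> leaves room for the triangle
      inequality: consecutive approximants are then within
      \<open>\<delta> n / 2 + \<delta> n / 4\<close> of each other.\<close>
    have "\<exists>m. d (a m) x < \<delta> n / 2" for n using dense[OF x, of "\<delta> n / 2"] \<delta>_pos[of n] by simp
    then obtain \<sigma> where \<sigma>: "\<And>n. d (a (\<sigma> n)) x < \<delta> n / 2" by metis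
    have "d (a (\<sigma> n)) (a (\<sigma> (Suc n))) \<le> \<delta> n" for n
      using \<sigma>[of n] \<sigma>[of "Suc n"] triangle[OF a x a, of "\<sigma> n" "\<sigma> (Suc n)"]
        commute[of x "a (\<sigma> (Suc n))"] \<delta>_Suc[of n] \<delta>_pos[of n] by linarith
    then have "\<sigma> \<in> D" by (simp add: D_def)
    have "d x (\<psi> \<sigma>) \<le> 0"
    proof (rule field_le_epsilon)
      fix \<epsilon> :: real assume "\<epsilon> > 0"
      then obtain n where "\<delta> n < \<epsilon> / 3" using \<delta>_lim[of "\<epsilon> / 3"] by auto
      then show "d x (\<psi> \<sigma>) \<le> 0 + \<epsilon>"
        using \<sigma>[of n] \<psi>(2)[OF \<open>\<sigma> \<in> D\<close>, of n] triangle[OF x a \<psi>(1)[OF \<open>\<sigma> \<in> D\<close>], of "\<sigma> n"]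
          commute[of x "a (\<sigma> n)"] \<delta>_pos[of n] by linarith
    qed
    then have "x = \<psi> \<sigma>" using x \<psi>(1)[OF \<open>\<sigma> \<in> D\<close>] nonneg[of x "\<psi> \<sigma>"] by (metis order_antisym zero)
    with \<open>\<sigma> \<in> D\<close> show "x \<in> \<psi> ` D" by blast
  qed (use \<psi>(1) T in auto)
  ultimately show ?thesis unfolding analytic_in_def using \<open>closed D\<close> by blast
qed simp

text \<open>Analytic sets are not closed under complements, so the induction over the generated
  sigma-algebra carries each set together with its complement. The base case uses that open sets of
  a metrizable space are countable unions of closed sets.\<close>

lemma analytic_in_Borel:
  assumes T: "completely_metrizable_space T" "second_countable T"
    and A: "A \<in> sigma_sets (topspace T) {U. openin T U}"
  shows "analytic_in T A"
proof -
  have metr: "metrizable_space T" using T(1) completely_metrizable_imp_metrizable_space by blast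
  have closed: "analytic_in T C" if "closedin T C" for C
    using analytic_in_Int_closedin[OF analytic_in_topspace[OF T] that] closedin_subset[OF that]
    by (simp add: Int_absorb1)
  have "open": "analytic_in T U" if U: "openin T U" for U
  proof -
    obtain C :: "nat \<Rightarrow> _" where C: "\<And>n. closedin T (C n)" "(\<Union>n. C n) = U"
      using open_imp_fsigma_in[OF metr U] unfolding fsigma_in_ascending by blast
    then show ?thesis using analytic_in_UN[of T C, OF closed] by simp
  qed
  from A have "analytic_in T A \<and> analytic_in T (topspace T - A)"
  proof (induction A)
    case (Basic U)
    then show ?case using "open" closed[OF closedin_diff[OF closedin_topspace]] by auto
  next
    case Empty
    then show ?case using analytic_in_topspace[OF T] by simp
  next
    case (Compl A)
    then have "A \<subseteq> topspace T" using analytic_in_subset_topspace by blast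
    then show ?case using Compl by (simp add: double_diff)
  next
    case (Union A)
    have "topspace T - (\<Union>i. A i) = (\<Inter>i. topspace T - A i)" by auto
    then show ?case using Union.IH
      by (metis analytic_in_UN analytic_in_INT[OF metrizable_imp_Hausdorff_space[OF metr]])
  qed
  then show ?thesis by simp
qed

text \<open>The same simultaneous induction, started from measurable rectangles; in this way the
  product sigma-algebra is never compared with the Borel sets of the product topology.\<close>

lemma analytic_in_pair_measure:
  assumes T: "completely_metrizable_space T" "second_countable T"
    and sets_M: "topspace T = space M" "sets M = sigma_sets (space M) {U. openin T U}"
    and P: "P \<in> sets (M \<Otimes>\<^sub>M M)"
  shows "analytic_in (prod_topology T T) P"
proof -
  let ?T2 = "prod_topology T T"
  have H: "Hausdorff_space ?T2"
    using T(1) by (simp add: Hausdorff_space_prod_topology completely_metrizable_imp_metrizable_space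
        metrizable_imp_Hausdorff_space)
  have B: "analytic_in T A" if "A \<in> sets M" for A
    using analytic_in_Borel[OF T] that sets_M by simp
  have rect: "analytic_in ?T2 (A \<times> B)" if "A \<in> sets M" "B \<in> sets M" for A B
    using analytic_in_Times B that by blast
  from P have "P \<in> sigma_sets (space M \<times> space M) {a \<times> b | a b. a \<in> sets M \<and> b \<in> sets M}"
    by (simp add: sets_pair_measure)
  then have "analytic_in ?T2 P \<and> analytic_in ?T2 (space M \<times> space M - P)"
  proof (induction P)
    case (Basic P)
    then obtain A B where AB: "P = A \<times> B" "A \<in> sets M" "B \<in> sets M" by auto
    have "space M \<times> space M - A \<times> B = (space M - A) \<times> space M \<union> space M \<times> (space M - B)" by auto
    then show ?case using AB rect by (auto intro!: analytic_in_Un)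
  next
    case Empty
    then show ?case using rect by simp
  next
    case (Compl A)
    then have "A \<subseteq> space M \<times> space M" using analytic_in_subset_topspace[of ?T2] sets_M by auto
    then show ?case using Compl by (simp add: double_diff)
  next
    case (Union A)
    have "space M \<times> space M - (\<Union>i. A i) = (\<Inter>i. space M \<times> space M - A i)" by auto
    then show ?case using Union.IH
      by (metis analytic_in_UN analytic_in_INT[OF H])
  qed
  then show ?thesis by simp
qed

section \<open>Separation and measurability of analytic sets\<close>

definition baire_cylinder :: "(nat \<Rightarrow> nat) set \<Rightarrow> (nat \<Rightarrow> nat) \<Rightarrow> nat \<Rightarrow> (nat \<Rightarrow> nat) set" where
  "baire_cylinder D \<sigma> n = {\<tau> \<in> D. \<forall>i<n. \<tau> i = \<sigma> i}"

lemma baire_cylinder_split: "baire_cylinder D \<sigma> n = (\<Union>j. baire_cylinder D (\<sigma>(n := j)) (Suc n))"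
  by (auto simp: baire_cylinder_def less_Suc_eq)

lemma mem_closed_if_baire_cylinder:
  assumes "closed D" "\<And>n. baire_cylinder D \<sigma> n \<noteq> {}"
  shows "\<sigma> \<in> D"
proof (rule ccontr)
  assume "\<sigma> \<notin> D"
  moreover have "open (- D)" using assms(1) by (rule open_Compl)
  ultimately obtain n where "\<And>\<tau>. \<forall>i<n. \<tau> i = \<sigma> i \<Longrightarrow> \<tau> \<notin> D"
    unfolding open_baire_iff by (metis ComplD ComplI)
  then show False using assms(2)[of n] by (auto simp: baire_cylinder_def)
qed

lemma continuous_map_baire_cylinder:
  assumes "continuous_map (top_of_set D) T \<psi>" "\<sigma> \<in> D" "openin T U" "\<psi> \<sigma> \<in> U"
  shows "\<exists>n. \<psi> ` baire_cylinder D \<sigma> n \<subseteq> U"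
  using conjunct2[OF assms(1)[unfolded continuous_map_baire], rule_format, OF assms(2-4)]
  by (auto simp: baire_cylinder_def image_subset_iff)

text \<open>If the images of two cylinders cannot be separated by a set in \<open>N\<close>, then neither can the
  images of some pair of immediate subcylinders; in the limit this yields two points of the two
  analytic sets, whose disjoint open neighbourhoods in \<open>N\<close> give a contradiction.\<close>

theorem lusin_separation:
  assumes A: "analytic_in T A" and B: "analytic_in T B" and disj: "A \<inter> B = {}"
    and space: "space N = topspace T"
    and hausdorff: "\<And>x y. x \<in> topspace T \<Longrightarrow> y \<in> topspace T \<Longrightarrow> x \<noteq> y \<Longrightarrow>
      \<exists>U V. openin T U \<and> openin T V \<and> U \<in> sets N \<and> V \<in> sets N \<and> x \<in> U \<and> y \<in> V \<and> U \<inter> V = {}"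
  obtains C where "C \<in> sets N" "A \<subseteq> C" "C \<inter> B = {}"
proof -
  obtain D :: "(nat \<Rightarrow> nat) set" and \<phi>
    where D: "closed D" "continuous_map (top_of_set D) T \<phi>" "A = \<phi> ` D" by (rule analytic_inE[OF A])
  obtain E :: "(nat \<Rightarrow> nat) set" and \<psi>
    where E: "closed E" "continuous_map (top_of_set E) T \<psi>" "B = \<psi> ` E" by (rule analytic_inE[OF B])
  define sep where "sep P Q \<longleftrightarrow> (\<exists>C\<in>sets N. P \<subseteq> C \<and> C \<inter> Q = {})" for P Q
  \<comment> \<open>Separators for all pairs combine into a union of intersections. Read
    contrapositively, this passes inseparability on to some pair of subcylinders.\<close>
  have sep_UN: "sep (\<Union>i. P i) (\<Union>j. Q j)" if "\<And>i j. sep (P i) (Q j)" for P Q :: "nat \<Rightarrow> _"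
  proof -
    have "\<exists>C. C \<in> sets N \<and> P i \<subseteq> C \<and> C \<inter> Q j = {}" for i j
      using that[of i j] unfolding sep_def by auto
    then obtain C where C: "\<And>i j. C i j \<in> sets N" "\<And>i j. P i \<subseteq> C i j" "\<And>i j. C i j \<inter> Q j = {}"
      by metis
    have "(\<Union>i. \<Inter>j. C i j) \<in> sets N" using C(1) by blast
    moreover have "(\<Union>i. P i) \<subseteq> (\<Union>i. \<Inter>j. C i j)" using C(2) by blast
    moreover have "(\<Union>i. \<Inter>j. C i j) \<inter> (\<Union>j. Q j) = {}" using C(3) by blast
    ultimately show ?thesis unfolding sep_def by blast
  qed
  define bad where "bad n p \<longleftrightarrow>
    \<not> sep (\<phi> ` baire_cylinder D (fst p) n) (\<psi> ` baire_cylinder E (snd p) n)" for n p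
  have step: "\<exists>i j. bad (Suc n) ((fst p)(n := i), (snd p)(n := j))" if "bad n p" for n p
  proof (rule ccontr)
    assume "\<not> ?thesis"
    then have "sep (\<Union>i. \<phi> ` baire_cylinder D ((fst p)(n := i)) (Suc n))
        (\<Union>j. \<psi> ` baire_cylinder E ((snd p)(n := j)) (Suc n))"
      by (intro sep_UN) (simp add: bad_def)
    then show False
      using that unfolding bad_def
      by (simp add: baire_cylinder_split[of D _ n] baire_cylinder_split[of E _ n] image_UN)
  qed
  have "sep A B"
  proof (rule ccontr)
    assume "\<not> sep A B"
    then have "bad 0 (\<lambda>_. 0, \<lambda>_. 0)" by (simp add: bad_def baire_cylinder_def D E)
    \<comment> \<open>Passing from \<open>f n\<close> to \<open>f (Suc n)\<close> changes entry
      \<open>n\<close> alone, so entries below \<open>n\<close> are final in \<open>f n\<close>.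
      This is why the limit sequences read their entry \<open>n\<close> off
      \<open>f (Suc n)\<close>.\<close>
    then obtain f where f: "\<And>n. bad n (f n)"
      "\<And>n. \<exists>i j. f (Suc n) = ((fst (f n))(n := i), (snd (f n))(n := j))"
      using dependent_nat_choice[of bad "\<lambda>n p q. \<exists>i j. q = ((fst p)(n := i), (snd p)(n := j))"] step
      by metis
    define \<sigma> \<tau> where "\<sigma> n = fst (f (Suc n)) n" and "\<tau> n = snd (f (Suc n)) n" for n
    have "fst (f (Suc n)) i = fst (f n) i \<and> snd (f (Suc n)) i = snd (f n) i" if "i < n" for i n
      using f(2)[of n] that by auto
    then have "fst (f (Suc i + k)) i = \<sigma> i \<and> snd (f (Suc i + k)) i = \<tau> i" for i k
      by (induction k) (auto simp: \<sigma>_def \<tau>_def)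
    then have eq: "fst (f n) i = \<sigma> i" "snd (f n) i = \<tau> i" if "i < n" for i n
      using that by (metis Suc_leI le_Suc_ex)+
    have nonsep: "\<not> sep (\<phi> ` baire_cylinder D \<sigma> n) (\<psi> ` baire_cylinder E \<tau> n)" for n
      using f(1)[of n] unfolding bad_def baire_cylinder_def by (simp add: eq)
    have "baire_cylinder D \<sigma> n \<noteq> {}" for n
      using nonsep[of n] by (auto simp: sep_def)
    moreover have "baire_cylinder E \<tau> n \<noteq> {}" for n
    proof
      assume "baire_cylinder E \<tau> n = {}"
      moreover have "\<phi> ` baire_cylinder D \<sigma> n \<subseteq> space N"
        using analytic_in_subset_topspace[OF A] D(3) space by (auto simp: baire_cylinder_def)
      ultimately have "sep (\<phi> ` baire_cylinder D \<sigma> n) (\<psi> ` baire_cylinder E \<tau> n)"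
        unfolding sep_def by (intro bexI[of _ "space N"]) auto
      then show False using nonsep by blast
    qed
    ultimately have \<sigma>: "\<sigma> \<in> D" and \<tau>: "\<tau> \<in> E"
      using mem_closed_if_baire_cylinder D(1) E(1) by blast+
    then have "\<phi> \<sigma> \<in> A" "\<psi> \<tau> \<in> B" using D E by auto
    moreover have "\<phi> \<sigma> \<noteq> \<psi> \<tau>" using calculation disj by auto
    moreover have "\<phi> \<sigma> \<in> topspace T" "\<psi> \<tau> \<in> topspace T"
      using calculation analytic_in_subset_topspace[OF A] analytic_in_subset_topspace[OF B] by auto
    ultimately obtain U V where UV: "openin T U" "openin T V" "U \<in> sets N" "\<phi> \<sigma> \<in> U" "\<psi> \<tau> \<in> V" "U \<inter> V = {}"
      using hausdorff[of "\<phi> \<sigma>" "\<psi> \<tau>"] by metis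
    obtain m n where m: "\<phi> ` baire_cylinder D \<sigma> m \<subseteq> U" and n: "\<psi> ` baire_cylinder E \<tau> n \<subseteq> V"
      using continuous_map_baire_cylinder[OF D(2) \<sigma> UV(1,4)]
        continuous_map_baire_cylinder[OF E(2) \<tau> UV(2,5)] by metis
    have "\<phi> ` baire_cylinder D \<sigma> (max m n) \<subseteq> U"
      using m by (auto simp: baire_cylinder_def image_subset_iff)
    moreover have "\<psi> ` baire_cylinder E \<tau> (max m n) \<subseteq> V"
      using n by (auto simp: baire_cylinder_def image_subset_iff)
    ultimately have "sep (\<phi> ` baire_cylinder D \<sigma> (max m n)) (\<psi> ` baire_cylinder E \<tau> (max m n))"
      unfolding sep_def using UV(3,6) by (intro bexI[of _ U]) auto
    then show False using nonsep by blast
  qed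
  then show ?thesis using that unfolding sep_def by blast
qed


text \<open>Bounding the coordinates of the parametrising sequences one after the other loses arbitrarily
  little outer measure and leaves a compact set of parameters.\<close>

lemma analytic_in_compact_approx:
  assumes metr: "metrizable_space T" and A: "analytic_in T A"
    and space: "topspace T = space M" and open_sets: "\<And>U. openin T U \<Longrightarrow> U \<in> sets M"
    and fin: "finite_measure M" and c: "c < outer_measure_of M A"
  obtains B where "B \<in> sets M" "B \<subseteq> A" "c \<le> emeasure M B"
proof -
  interpret finite_measure M by (rule fin)
  obtain D :: "(nat \<Rightarrow> nat) set" and \<psi>
    where D: "closed D" "continuous_map (top_of_set D) T \<psi>" "A = \<psi> ` D" by (rule analytic_inE[OF A])
  have A_space: "A \<subseteq> space M" using analytic_in_subset_topspace[OF A] space by simp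
  define E where "E \<nu> n = {\<sigma> \<in> D. \<forall>i<n. \<sigma> i \<le> \<nu> i}" for \<nu> :: "nat \<Rightarrow> nat" and n
  \<comment> \<open>Outer measure is continuous along increasing sequences of arbitrary sets, so a
    large enough bound on entry \<open>n\<close> keeps it above \<open>c\<close>.\<close>
  have step: "\<exists>m. c < outer_measure_of M (\<psi> ` E (\<nu>(n := m)) (Suc n))"
    if c: "c < outer_measure_of M (\<psi> ` E \<nu> n)" for \<nu> n
  proof -
    have eq: "E \<nu> n = (\<Union>m. E (\<nu>(n := m)) (Suc n))"
    proof (intro subset_antisym subsetI)
      fix \<sigma> assume "\<sigma> \<in> E \<nu> n"
      then have "\<sigma> \<in> E (\<nu>(n := \<sigma> n)) (Suc n)" by (auto simp: E_def less_Suc_eq)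
      then show "\<sigma> \<in> (\<Union>m. E (\<nu>(n := m)) (Suc n))" by blast
    next
      fix \<sigma> assume "\<sigma> \<in> (\<Union>m. E (\<nu>(n := m)) (Suc n))"
      then obtain m where m: "\<sigma> \<in> E (\<nu>(n := m)) (Suc n)" by blast
      then have "\<sigma> i \<le> \<nu> i" if "i < n" for i
        using that unfolding E_def by (auto dest: spec[of _ i])
      with m show "\<sigma> \<in> E \<nu> n" by (simp add: E_def)
    qed
    have "(SUP m. outer_measure_of M (\<psi> ` E (\<nu>(n := m)) (Suc n)))
        = outer_measure_of M (\<Union>m. \<psi> ` E (\<nu>(n := m)) (Suc n))"
    proof (rule SUP_outer_measure_of_incseq)
      show "\<psi> ` E (\<nu>(n := m)) (Suc n) \<subseteq> space M" for m using A_space D(3) by (auto simp: E_def)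
      show "incseq (\<lambda>m. \<psi> ` E (\<nu>(n := m)) (Suc n))"
        by (intro monoI image_mono) (auto simp: E_def less_Suc_eq)
    qed
    moreover have "\<psi> ` E \<nu> n = (\<Union>m. \<psi> ` E (\<nu>(n := m)) (Suc n))" by (subst eq) (rule image_UN)
    ultimately have "c < (SUP m. outer_measure_of M (\<psi> ` E (\<nu>(n := m)) (Suc n)))" using c by simp
    then show ?thesis by (simp add: less_SUP_iff)
  qed
  have "c < outer_measure_of M (\<psi> ` E (\<lambda>_. 0) 0)" using c D(3) by (simp add: E_def)
  then obtain f where f: "\<And>n. c < outer_measure_of M (\<psi> ` E (f n) n)" "\<And>n. \<exists>m. f (Suc n) = (f n)(n := m)"
    using dependent_nat_choice[of "\<lambda>n \<nu>. c < outer_measure_of M (\<psi> ` E \<nu> n)" "\<lambda>n \<nu> \<nu>'. \<exists>m. \<nu>' = \<nu>(n := m)"] step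
    by metis
  define \<nu> where "\<nu> n = f (Suc n) n" for n
  have "f (Suc n) i = f n i" if "i < n" for i n using f(2)[of n] that by auto
  then have "f (Suc i + k) i = \<nu> i" for i k by (induction k) (auto simp: \<nu>_def)
  then have "f n i = \<nu> i" if "i < n" for i n using that by (metis Suc_leI le_Suc_ex)
  then have c_less: "c < outer_measure_of M (\<psi> ` E \<nu> n)" for n
    using f(1)[of n] by (simp add: E_def)
  define C where "C = {\<sigma>. \<forall>i. \<sigma> i \<le> \<nu> i}"
  have "compact C"
  proof -
    have "C = (\<Pi>\<^sub>E i\<in>UNIV. {..\<nu> i})" by (auto simp: C_def PiE_iff)
    moreover have "compactin (product_topology (\<lambda>i. euclidean) UNIV) (\<Pi>\<^sub>E i\<in>UNIV. {..\<nu> i})"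
      by (auto simp: compactin_PiE finite_imp_compact)
    ultimately show ?thesis by (simp add: euclidean_product_topology)
  qed
  then have "compact (D \<inter> C)" using D(1) closed_Int_compact by blast
  then have "compactin (top_of_set D) (D \<inter> C)" by (simp add: compactin_subtopology)
  then have "compactin T (\<psi> ` (D \<inter> C))" using image_compactin D(2) by blast
  then have "closedin T (\<psi> ` (D \<inter> C))"
    using compactin_imp_closedin metrizable_imp_Hausdorff_space[OF metr] by blast
  then obtain U :: "nat \<Rightarrow> _" where U: "\<And>n. openin T (U n)" "\<And>n. U (Suc n) \<subseteq> U n" "(\<Inter>n. U n) = \<psi> ` (D \<inter> C)"
    using closed_imp_gdelta_in[OF metr, of "\<psi> ` (D \<inter> C)"] unfolding gdelta_in_descending by metis
  \<comment> \<open>The sets \<open>E \<nu> m\<close> decrease to \<open>D \<inter> C\<close>, but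
    outer measure need not be continuous along decreasing sequences of non-measurable sets.
    Compactness of \<open>C\<close> takes over: some \<open>E \<nu> m\<close> is already mapped into
    the open set \<open>U n\<close>.\<close>
  have le: "c \<le> emeasure M (U n)" for n
  proof -
    have "\<exists>m. \<psi> ` E \<nu> m \<subseteq> U n"
    proof (rule ccontr)
      assume "\<not> ?thesis"
      then have "\<exists>\<sigma>. \<sigma> \<in> E \<nu> m \<and> \<psi> \<sigma> \<notin> U n" for m by blast
      then obtain \<sigma> where \<sigma>: "\<And>m. \<sigma> m \<in> E \<nu> m" "\<And>m. \<psi> (\<sigma> m) \<notin> U n" by metis
      \<comment> \<open>Truncation moves the sequences into \<open>C\<close>, where a subsequence
        converges, and leaves the first \<open>m\<close> entries of \<open>\<sigma> m\<close>
        unchanged.\<close>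
      define \<tau> where "\<tau> m = (\<lambda>i. min (\<sigma> m i) (\<nu> i))" for m
      have "seq_compact C" using \<open>compact C\<close> by (rule compact_imp_seq_compact)
      moreover have "\<forall>m. \<tau> m \<in> C" by (simp add: C_def \<tau>_def)
      ultimately obtain \<rho> r where \<rho>: "\<rho> \<in> C" "strict_mono (r :: nat \<Rightarrow> nat)" "(\<tau> \<circ> r) \<longlonglongrightarrow> \<rho>"
        by (rule seq_compactE)
      have agree: "\<exists>m. \<forall>i<k. \<sigma> m i = \<rho> i" for k
      proof -
        have "open {\<tau>. \<forall>i<k. \<tau> i = \<rho> i}" 
          unfolding open_baire_iff by (intro ballI exI[of _ k]) simp
        then have "eventually (\<lambda>m. (\<tau> \<circ> r) m \<in> {\<tau>. \<forall>i<k. \<tau> i = \<rho> i}) sequentially"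
          by (rule topological_tendstoD[OF \<rho>(3)]) simp
        then obtain N where N: "\<And>m. N \<le> m \<Longrightarrow> \<forall>i<k. \<tau> (r m) i = \<rho> i"
          unfolding eventually_sequentially by auto
        \<comment> \<open>The index \<open>max N k\<close> is late enough for the convergence and
          also forces \<open>k \<le> m\<close>, so that truncation is invisible on the first
          \<open>k\<close> entries.\<close>
        define m where "m = r (max N k)"
        have "k \<le> m" unfolding m_def using seq_suble[OF \<rho>(2), of "max N k"] by simp
        have "\<sigma> m i = \<rho> i" if "i < k" for i
        proof -
          have "\<sigma> m i \<le> \<nu> i" using \<sigma>(1)[of m] that \<open>k \<le> m\<close> by (simp add: E_def)
          then have "\<sigma> m i = \<tau> m i" by (simp add: \<tau>_def)
          then show ?thesis using N[of "max N k"] that by (simp add: m_def)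
        qed
        then show ?thesis by blast
      qed
      have "\<rho> \<in> D"
      proof (rule mem_closed_if_baire_cylinder[OF D(1)])
        fix k
        obtain m where "\<forall>i<k. \<sigma> m i = \<rho> i" using agree by blast
        then show "baire_cylinder D \<rho> k \<noteq> {}" using \<sigma>(1)[of m] by (auto simp: E_def baire_cylinder_def)
      qed
      then have "\<psi> \<rho> \<in> U n" using \<rho>(1) U(3) by blast
      then obtain k where k: "\<psi> ` baire_cylinder D \<rho> k \<subseteq> U n"
        using continuous_map_baire_cylinder[OF D(2) \<open>\<rho> \<in> D\<close> U(1)] by blast
      obtain m where "\<forall>i<k. \<sigma> m i = \<rho> i" using agree by blast
      then have "\<sigma> m \<in> baire_cylinder D \<rho> k" using \<sigma>(1)[of m] by (simp add: E_def baire_cylinder_def)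
      then show False using k \<sigma>(2) by blast
    qed
    then obtain m where "\<psi> ` E \<nu> m \<subseteq> U n" by blast
    then have "outer_measure_of M (\<psi> ` E \<nu> m) \<le> outer_measure_of M (U n)" by (rule outer_measure_of_mono)
    then show ?thesis using c_less[of m] U(1) open_sets by simp
  qed
  have "(INF n. emeasure M (U n)) = emeasure M (\<Inter>n. U n)"
    using U(1,2) open_sets by (intro INF_emeasure_decseq decseq_SucI) auto
  then have "c \<le> emeasure M (\<psi> ` (D \<inter> C))" using le U(3) by (metis INF_greatest)
  moreover have "\<psi> ` (D \<inter> C) \<in> sets M"
    unfolding U(3)[symmetric] using U(1) open_sets by (intro sets.countable_INT) auto
  ultimately show ?thesis using that D(3) by blast
qed

text \<open>This is measurability of analytic sets in a form suited to a measure that need not be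
  complete. The supremum of the inner approximations is attained by the union of a maximising
  sequence.\<close>

lemma analytic_in_inner_regular:
  assumes "metrizable_space T" "analytic_in T A" "topspace T = space M"
    "\<And>U. openin T U \<Longrightarrow> U \<in> sets M" "finite_measure M"
  obtains B where "B \<in> sets M" "B \<subseteq> A" "emeasure M B = outer_measure_of M A"
proof -
  let ?\<B> = "{B \<in> sets M. B \<subseteq> A}"
  have "outer_measure_of M A \<le> (SUP B\<in>?\<B>. emeasure M B)"
  proof (rule dense_le)
    fix c assume "c < outer_measure_of M A"
    then obtain B where "B \<in> ?\<B>" "c \<le> emeasure M B"
      using analytic_in_compact_approx[OF assms] by blast
    then show "c \<le> (SUP B\<in>?\<B>. emeasure M B)" by (meson SUP_upper2)
  qed
  moreover obtain f :: "nat \<Rightarrow> _" where f: "range f \<subseteq> emeasure M ` ?\<B>" "(SUP B\<in>?\<B>. emeasure M B) = (SUP n. f n)"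
    using ennreal_Sup_countable_SUP[of "emeasure M ` ?\<B>"] by blast
  then have "\<exists>B\<in>?\<B>. f n = emeasure M B" for n by blast
  then obtain B where B: "\<And>n. B n \<in> ?\<B>" "\<And>n. f n = emeasure M (B n)" by metis
  have UN: "(\<Union>n. B n) \<in> sets M" "(\<Union>n. B n) \<subseteq> A" using B(1) by auto
  have "f n \<le> emeasure M (\<Union>n. B n)" for n
    unfolding B(2) using UN(1) by (intro emeasure_mono) auto
  then have "(SUP n. f n) \<le> emeasure M (\<Union>n. B n)" by (rule SUP_least)
  moreover have "emeasure M (\<Union>n. B n) \<le> outer_measure_of M A"
    using outer_measure_of_mono[OF UN(2), of M] UN(1) by simp
  ultimately show ?thesis using that UN f(2) by (metis order_antisym order_trans)
qed

section \<open>Weights of walks in forests\<close>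

fun walk_weight :: "('g, 'm) monoid_scheme \<Rightarrow> ('a \<times> 'a \<Rightarrow> 'g) \<Rightarrow> 'a list \<Rightarrow> 'g" where
  "walk_weight G w (x # y # ys) = w (x, y) \<otimes>\<^bsub>G\<^esub> walk_weight G w (y # ys)"
| "walk_weight G w _ = \<one>\<^bsub>G\<^esub>"

text \<open>Apart from loops, only closed walks through at least three distinct vertices are
  excluded, as in \<open>is_cycle\<close>. Running back and forth along an edge is allowed, and
  \<open>weight_inv\<close> makes its contribution trivial.\<close>

locale weighted_forest = group G for G :: "('g, 'm) monoid_scheme" (structure) +
  fixes E :: "'a rel" and w :: "'a \<times> 'a \<Rightarrow> 'g"
  assumes sym_E: "sym E"
    and irrefl_E: "(x, x) \<notin> E"
    and acyclic_E: "3 \<le> length vs \<Longrightarrow> distinct vs \<Longrightarrow>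
      \<exists>i<length vs. (vs ! i, vs ! (Suc i mod length vs)) \<notin> E"
    and weight_closed: "p \<in> E \<Longrightarrow> w p \<in> carrier G"
    and weight_inv: "(x, y) \<in> E \<Longrightarrow> w (y, x) = inv w (x, y)"
begin

abbreviation walk :: "'a list \<Rightarrow> bool" where
  "walk xs \<equiv> successively (\<lambda>x y. (x, y) \<in> E) xs"

lemma walk_weight_closed: "walk xs \<Longrightarrow> walk_weight G w xs \<in> carrier G"
  by (induction xs rule: induct_list012) (auto simp: weight_closed)

lemma walk_weight_append:
  "walk (xs @ v # ys) \<Longrightarrow> walk_weight G w (xs @ v # ys) =
     walk_weight G w (xs @ [v]) \<otimes> walk_weight G w (v # ys)"
proof (induction xs)
  case Nil
  then show ?case using walk_weight_closed[of "v # ys"] by simp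
next
  case (Cons x xs)
  show ?case
  proof (cases xs)
    case Nil
    then show ?thesis using Cons.prems weight_closed[of "(x, v)"] by simp
  next
    case (Cons y zs)
    have walks: "walk (y # zs @ v # ys)" "(x, y) \<in> E" "walk (y # zs @ [v])" "walk (v # ys)"
      using Cons.prems unfolding Cons by (auto simp: successively_append_iff successively_Cons hd_append)
    then show ?thesis
      using Cons.IH weight_closed[OF walks(2)] walk_weight_closed[OF walks(3)] walk_weight_closed[OF walks(4)]
      unfolding Cons by (simp add: m_assoc)
  qed
qed

lemma walk_rev: "walk xs \<Longrightarrow> walk (rev xs)"
  unfolding successively_rev using sym_E by (elim successively_mono) (auto dest: symD)

lemma walk_weight_rev: "walk xs \<Longrightarrow> walk_weight G w (rev xs) = inv walk_weight G w xs"
proof (induction xs rule: induct_list012)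
  case (3 x y ys)
  then have walk: "walk (rev ys @ y # [x])" "walk (y # ys)" and xy: "(x, y) \<in> E"
    using walk_rev[of "x # y # ys"] by simp_all
  have "(y, x) \<in> E" using xy sym_E by (simp add: symD)
  then show ?case
    using walk_weight_append[OF walk(1)] 3 walk_weight_closed[OF walk(2)] weight_closed[of "(x, y)"]
      weight_closed[of "(y, x)"] weight_inv[OF xy] xy by (simp add: inv_mult_group)
qed auto

text \<open>Path independence. A repeated vertex splits the walk into two shorter closed walks.
  Without repetition it is a single point, an edge traversed back and forth, or else a loop or
  cycle, which a forest excludes.\<close>

lemma closed_walk_weight:
  "walk xs \<Longrightarrow> xs \<noteq> [] \<Longrightarrow> hd xs = last xs \<Longrightarrow> walk_weight G w xs = \<one>"
proof (induction "length xs" arbitrary: xs rule: less_induct)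
  case less
  \<comment> \<open>The last vertex repeats the first by assumption, so repetitions are looked for
    in \<open>vs\<close> only.\<close>
  define vs l where "vs = butlast xs" and "l = last xs"
  have xs: "xs = vs @ [l]" using less.prems(2) by (simp add: vs_def l_def)
  show ?case
  proof (cases "distinct vs")
    case False
    then obtain as bs cs y where vs: "vs = as @ [y] @ bs @ [y] @ cs" using not_distinct_decomp by blast
    have w1: "walk ((as @ [y]) @ (bs @ y # cs @ [l]))" using less.prems(1) unfolding xs vs by simp
    have w2: "walk (as @ [y])" "walk (y # bs @ [y])" "walk (y # cs @ [l])"
      using w1 by (auto simp: successively_append_iff successively_Cons hd_append)
    have w3: "walk (as @ y # cs @ [l])"
      using w2 by (cases as) (auto simp: successively_append_iff successively_Cons hd_append)
    have "walk_weight G w (y # bs @ [y]) = \<one>"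
      using less.hyps[of "y # bs @ [y]"] w2(2) unfolding xs vs by simp
    moreover have "walk_weight G w (as @ y # cs @ [l]) = \<one>"
    proof -
      have "hd (as @ y # cs @ [l]) = last (as @ y # cs @ [l])"
        using less.prems(3) unfolding xs vs by (cases as) auto
      then show ?thesis using less.hyps[of "as @ y # cs @ [l]"] w3 unfolding xs vs by simp
    qed
    moreover have "walk_weight G w xs = walk_weight G w (as @ [y]) \<otimes>
        (walk_weight G w (y # bs @ [y]) \<otimes> walk_weight G w (y # cs @ [l]))"
    proof -
      have "walk (y # bs @ y # cs @ [l])" using w1 by (auto simp: successively_append_iff successively_Cons hd_append)
      then show ?thesis
        using walk_weight_append[of as y "bs @ y # cs @ [l]"] w1
          walk_weight_append[of "y # bs" y "cs @ [l]"] unfolding xs vs by simp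
    qed
    moreover have "walk_weight G w (as @ y # cs @ [l]) =
        walk_weight G w (as @ [y]) \<otimes> walk_weight G w (y # cs @ [l])"
      using walk_weight_append[OF w3] .
    ultimately show ?thesis using walk_weight_closed w2 by simp
  next
    case True
    have walk: "walk (vs @ [l])" using less.prems(1) xs by simp
    have hd_l: "vs \<noteq> [] \<Longrightarrow> hd vs = l" using less.prems(3) xs by simp
    consider "vs = []" | a where "vs = [a]" | a b where "vs = [a, b]" | "3 \<le> length vs"
    proof (cases vs rule: remdups_adj.cases)
      case (3 x y xs)
      then show ?thesis using that by (cases xs) auto
    qed (use that in auto)
    then show ?thesis
    proof cases
      case 1
      then show ?thesis using xs by simp
    next
      case 2
      then show ?thesis using walk hd_l irrefl_E by simp
    next
      case (3 a b)
      then have "xs = [a, b, a]" "(a, b) \<in> E" using hd_l xs walk by auto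
      then show ?thesis using weight_inv[of a b] weight_closed[of "(a, b)"] by simp
    next
      case 4
      have "(vs ! i, vs ! (Suc i mod length vs)) \<in> E" if "i < length vs" for i
      proof -
        have "((vs @ [l]) ! i, (vs @ [l]) ! Suc i) \<in> E"
          using walk that by (simp add: successively_conv_nth)
        moreover have "(vs @ [l]) ! Suc i = vs ! (Suc i mod length vs)"
        proof (cases "Suc i < length vs")
          case False
          then have "Suc i = length vs" using that by simp
          moreover have "vs \<noteq> []" using that by auto
          ultimately show ?thesis using hd_l by (simp add: nth_append hd_conv_nth)
        qed (simp add: nth_append)
        ultimately show ?thesis using that by (simp add: nth_append)
      qed
      then show ?thesis using acyclic_E[OF 4 True] by blast
    qed
  qed
qed

definition connected_weight :: "'g \<Rightarrow> 'a rel" where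
  "connected_weight g = {(x, y). \<exists>xs. xs \<noteq> [] \<and> hd xs = x \<and> last xs = y \<and> walk xs \<and> walk_weight G w xs = g}"

lemma connected_weightI:
  "xs \<noteq> [] \<Longrightarrow> walk xs \<Longrightarrow> walk_weight G w xs = g \<Longrightarrow> (hd xs, last xs) \<in> connected_weight g"
  by (auto simp: connected_weight_def)

lemma connected_weight_closed: "(x, y) \<in> connected_weight g \<Longrightarrow> g \<in> carrier G"
  using walk_weight_closed by (auto simp: connected_weight_def)

lemma connected_weight_refl: "(x, x) \<in> connected_weight \<one>"
  using connected_weightI[of "[x]"] by simp

lemma connected_weight_trans:
  assumes "(x, y) \<in> connected_weight g" "(y, z) \<in> connected_weight h"
  shows "(x, z) \<in> connected_weight (g \<otimes> h)"
proof -
  from assms(1) obtain xs where xs: "xs \<noteq> []" "hd xs = x" "last xs = y" "walk xs" "walk_weight G w xs = g"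
    by (auto simp: connected_weight_def)
  from assms(2) obtain ys where ys: "ys \<noteq> []" "hd ys = y" "last ys = z" "walk ys" "walk_weight G w ys = h"
    by (auto simp: connected_weight_def)
  define as bs where "as = butlast xs" and "bs = tl ys"
  have as: "xs = as @ [y]" using xs by (auto simp: as_def)
  have bs: "ys = y # bs" using ys unfolding bs_def by (metis list.collapse)
  have walk: "walk (as @ y # bs)"
    using xs(4) ys(4) unfolding as bs by (auto simp: successively_append_iff successively_Cons hd_append)
  have "walk_weight G w (as @ y # bs) = g \<otimes> h"
    using walk_weight_append[OF walk] xs ys as bs by simp
  moreover have "hd (as @ y # bs) = x" "last (as @ y # bs) = z"
    using xs(2) ys(3) unfolding as bs by (cases as; simp)+
  ultimately show ?thesis using connected_weightI[OF _ walk] by fastforce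
qed

lemma connected_weight_sym:
  assumes "(x, y) \<in> connected_weight g"
  shows "(y, x) \<in> connected_weight (inv g)"
proof -
  from assms obtain xs where xs: "xs \<noteq> []" "hd xs = x" "last xs = y" "walk xs" "walk_weight G w xs = g"
    by (auto simp: connected_weight_def)
  then have "walk_weight G w (rev xs) = inv g" "rev xs \<noteq> []"
    using walk_weight_rev[OF xs(4)] by auto
  then show ?thesis
    using connected_weightI[of "rev xs", OF _ walk_rev[OF xs(4)]] xs by (simp add: hd_rev last_rev)
qed

text \<open>One walk followed by the reverse of the other is closed, so its weight is
  trivial.\<close>

lemma connected_weight_unique:
  assumes "(x, y) \<in> connected_weight g" "(x, y) \<in> connected_weight h"
  shows "g = h"
proof -
  have "(x, x) \<in> connected_weight (g \<otimes> inv h)"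
    using connected_weight_trans[OF assms(1) connected_weight_sym[OF assms(2)]] .
  then have "g \<otimes> inv h = \<one>"
    using closed_walk_weight unfolding connected_weight_def by force
  then show ?thesis
    using assms connected_weight_closed by (metis inv_equality inv_inv inv_closed)
qed

lemma connected_weight_edge: "(x, y) \<in> E \<Longrightarrow> (x, y) \<in> connected_weight (w (x, y))"
  using connected_weightI[of "[x, y]"] weight_closed by simp

end

text \<open>An \<open>E\<close>-cycle stays inside a single \<open>R\<close>-class, so it would
  already be a cycle of the local graph at its vertex \<open>vs ! 0\<close>.\<close>

lemma treeing_imp_no_cycle:
  assumes R: "equiv (space M) R" and E: "treeing M R E"
  shows "(x, x) \<notin> E"
    and "3 \<le> length vs \<Longrightarrow> distinct vs \<Longrightarrow> \<exists>i<length vs. (vs ! i, vs ! (Suc i mod length vs)) \<notin> E"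
proof -
  have ER: "E \<subseteq> R" using E by (simp add: treeing_def graphing_def)
  have RM: "R \<subseteq> space M \<times> space M" and "trans R" "refl_on (space M) R" using R by (auto simp: equiv_def)
  have tree: "is_tree (R `` {x}) (local_edges R E x)" if "x \<in> space M" for x
    using E that by (simp add: treeing_def)
  show "(x, x) \<notin> E"
  proof
    assume x: "(x, x) \<in> E"
    then have "x \<in> space M" "(x, x) \<in> R" using ER RM by auto
    with x have "{x, x} \<in> local_edges R E x" unfolding local_edges_def by blast
    then have "\<exists>u v. {x} = {u, v} \<and> u \<noteq> v"
      using tree[OF \<open>x \<in> space M\<close>] unfolding is_tree_def by auto
    then show False by (metis doubleton_eq_iff insert_absorb2)
  qed
  show "\<exists>i<length vs. (vs ! i, vs ! (Suc i mod length vs)) \<notin> E" if vs: "3 \<le> length vs" "distinct vs"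
  proof (rule ccontr)
    assume "\<not> ?thesis"
    then have cyc: "(vs ! i, vs ! (Suc i mod length vs)) \<in> E" if "i < length vs" for i using that by blast
    have "vs ! 0 \<in> space M" using cyc[of 0] vs ER RM by fastforce
    then have R0: "(vs ! 0, vs ! i) \<in> R" if "i < length vs" for i
      using that
    proof (induction i)
      case 0
      then show ?case using \<open>refl_on (space M) R\<close> by (simp add: refl_on_def)
    next
      case (Suc i)
      then have "(vs ! 0, vs ! i) \<in> R" "(vs ! i, vs ! Suc i) \<in> R" using cyc[of i] ER by auto
      then show ?case using \<open>trans R\<close> by (blast dest: transD)
    qed
    have "{vs ! i, vs ! (Suc i mod length vs)} \<in> local_edges R E (vs ! 0)" if "i < length vs" for i
    proof -
      have "Suc i mod length vs < length vs" using that by (intro mod_less_divisor) auto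
      then show ?thesis unfolding local_edges_def using cyc[OF that] R0 that by blast
    qed
    then have "is_cycle (local_edges R E (vs ! 0)) vs" using vs by (simp add: is_cycle_def)
    then show False using tree[OF \<open>vs ! 0 \<in> space M\<close>] unfolding is_tree_def by blast
  qed
qed

lemma treeing_connected:
  assumes R: "equiv (space M) R" and E: "treeing M R E" and "(x, y) \<in> R"
  shows "(x, y) \<in> E\<^sup>*"
proof -
  have "sym E" using E by (simp add: treeing_def graphing_def)
  have "x \<in> space M" "(x, x) \<in> R" using assms by (auto simp: equiv_def refl_on_def)
  then have "(x, y) \<in> {(a, b). {a, b} \<in> local_edges R E x}\<^sup>*"
    using E \<open>(x, y) \<in> R\<close> by (auto simp: treeing_def is_tree_def)
  moreover have "{(a, b). {a, b} \<in> local_edges R E x} \<subseteq> E"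
    using \<open>sym E\<close> by (auto simp: local_edges_def doubleton_eq_iff dest: symD)
  ultimately show ?thesis using rtrancl_mono by blast
qed

section \<open>Saturations under Borel equivalence relations\<close>

locale polish_measurable_space =
  fixes M :: "'a measure" and T :: "'a topology"
  assumes topspace_eq: "topspace T = space M"
    and completely_metrizable: "completely_metrizable_space T"
    and second_countable: "second_countable T"
    and sets_eq: "sets M = sigma_sets (space M) {U. openin T U}"
begin

lemma metrizable: "metrizable_space T"
  using completely_metrizable by (rule completely_metrizable_imp_metrizable_space)

lemma Hausdorff: "Hausdorff_space T"
  using metrizable by (rule metrizable_imp_Hausdorff_space)

lemma openin_imp_sets: "openin T U \<Longrightarrow> U \<in> sets M"
  unfolding sets_eq by (rule sigma_sets.Basic) simp

lemma sets_imp_analytic: "A \<in> sets M \<Longrightarrow> analytic_in T A"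
  using analytic_in_Borel[OF completely_metrizable second_countable] by (simp add: topspace_eq sets_eq)

lemma sets_pair_imp_analytic: "P \<in> sets (M \<Otimes>\<^sub>M M) \<Longrightarrow> analytic_in (prod_topology T T) P"
  using analytic_in_pair_measure[OF completely_metrizable second_countable topspace_eq sets_eq] .

lemma singleton_sets: "x \<in> space M \<Longrightarrow> {x} \<in> sets M"
proof -
  assume "x \<in> space M"
  then have "closedin T {x}" using Hausdorff Hausdorff_imp_t1_space t1_space_closedin_singleton topspace_eq by metis
  then have "space M - (topspace T - {x}) \<in> sets M"
    by (intro sets.compl_sets openin_imp_sets openin_diff) auto
  moreover have "space M - (topspace T - {x}) = {x}" using \<open>x \<in> space M\<close> by (auto simp: topspace_eq)
  ultimately show ?thesis by simp
qed

lemma separation: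
  assumes "analytic_in T A" "analytic_in T B" "A \<inter> B = {}"
  obtains C where "C \<in> sets M" "A \<subseteq> C" "C \<inter> B = {}"
proof (rule lusin_separation[OF assms, of M])
  show "\<exists>U V. openin T U \<and> openin T V \<and> U \<in> sets M \<and> V \<in> sets M \<and> x \<in> U \<and> y \<in> V \<and> U \<inter> V = {}"
    if "x \<in> topspace T" "y \<in> topspace T" "x \<noteq> y" for x y
    using Hausdorff that openin_imp_sets unfolding Hausdorff_space_def disjnt_def by metis
qed (use topspace_eq that in auto)

text \<open>Distinct pairs differ in some coordinate. Strips over disjoint open sets in that
  coordinate are open and lie in the product sigma-algebra, which is what
  \<open>lusin_separation\<close> asks for.\<close>

lemma pair_separation:
  assumes "analytic_in (prod_topology T T) P" "analytic_in (prod_topology T T) Q" "P \<inter> Q = {}"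
  obtains C where "C \<in> sets (M \<Otimes>\<^sub>M M)" "P \<subseteq> C" "C \<inter> Q = {}"
proof (rule lusin_separation[OF assms, of "M \<Otimes>\<^sub>M M"])
  have top: "openin T (space M)" using openin_topspace[of T] by (simp add: topspace_eq)
  fix x y assume xy: "x \<in> topspace (prod_topology T T)" "y \<in> topspace (prod_topology T T)" "x \<noteq> y"
  show "\<exists>U V. openin (prod_topology T T) U \<and> openin (prod_topology T T) V \<and> U \<in> sets (M \<Otimes>\<^sub>M M) \<and>
      V \<in> sets (M \<Otimes>\<^sub>M M) \<and> x \<in> U \<and> y \<in> V \<and> U \<inter> V = {}"
  proof (cases "fst x = fst y")
    case False
    then obtain U V where UV: "openin T U" "openin T V" "fst x \<in> U" "fst y \<in> V" "U \<inter> V = {}"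
      using Hausdorff xy unfolding Hausdorff_space_def disjnt_def by (metis mem_Times_iff topspace_prod_topology)
    show ?thesis
      by (rule exI[of _ "U \<times> topspace T"], rule exI[of _ "V \<times> topspace T"])
        (use UV xy top in \<open>auto simp: openin_prod_Times_iff openin_imp_sets topspace_eq mem_Times_iff\<close>)
  next
    case True
    then have "snd x \<noteq> snd y" using xy(3) by (simp add: prod_eq_iff)
    then obtain U V where UV: "openin T U" "openin T V" "snd x \<in> U" "snd y \<in> V" "U \<inter> V = {}"
      using Hausdorff xy unfolding Hausdorff_space_def disjnt_def by (metis mem_Times_iff topspace_prod_topology)
    show ?thesis
      by (rule exI[of _ "topspace T \<times> U"], rule exI[of _ "topspace T \<times> V"])
        (use UV xy top in \<open>auto simp: openin_prod_Times_iff openin_imp_sets topspace_eq mem_Times_iff\<close>)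
  qed
qed (use topspace_eq that in \<open>auto simp: space_pair_measure\<close>)

text \<open>The other pieces are countably many, so their union is analytic and can be separated
  from \<open>P i\<close>. The separating set cut down to the total is \<open>P i\<close>
  itself.\<close>

lemma analytic_partition_sets:
  assumes "countable I" and analytic: "\<And>i. i \<in> I \<Longrightarrow> analytic_in (prod_topology T T) (P i)"
    and disj: "disjoint_family_on P I" and R: "(\<Union>i\<in>I. P i) \<in> sets (M \<Otimes>\<^sub>M M)" and "i \<in> I"
  shows "P i \<in> sets (M \<Otimes>\<^sub>M M)"
proof -
  have "analytic_in (prod_topology T T) (\<Union>j\<in>I - {i}. P j)"
    using assms by (intro analytic_in_countable_UN) auto
  moreover have "P i \<inter> (\<Union>j\<in>I - {i}. P j) = {}"
    using disj \<open>i \<in> I\<close> unfolding disjoint_family_on_def by blast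
  ultimately obtain C where C: "C \<in> sets (M \<Otimes>\<^sub>M M)" "P i \<subseteq> C" "C \<inter> (\<Union>j\<in>I - {i}. P j) = {}"
    using pair_separation[OF analytic[OF \<open>i \<in> I\<close>]] by metis
  have "P i = C \<inter> (\<Union>i\<in>I. P i)" using C(2,3) \<open>i \<in> I\<close> by blast
  then show ?thesis using sets.Int[OF C(1) R] by simp
qed

lemma analytic_in_Domain: "analytic_in (prod_topology T T) P \<Longrightarrow> analytic_in T (Domain P)"
  unfolding Domain_fst by (rule analytic_in_image[OF _ continuous_map_fst])

lemma analytic_in_Image:
  assumes "analytic_in (prod_topology T T) P" "analytic_in T A"
  shows "analytic_in T (P `` A)"
proof -
  let ?T2 = "prod_topology T T"
  have "analytic_in ?T2 (A \<times> space M)"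
    using analytic_in_Times[OF assms(2) sets_imp_analytic[OF sets.top]] .
  then have "analytic_in T (snd ` (P \<inter> A \<times> space M))"
    using assms(1) Hausdorff by (intro analytic_in_image[OF _ continuous_map_snd] analytic_in_Int)
      (auto simp: Hausdorff_space_prod_topology)
  moreover have "snd ` (P \<inter> A \<times> space M) = P `` A"
    using analytic_in_subset_topspace[OF assms(1)] by (force simp: topspace_eq)
  ultimately show ?thesis by simp
qed

text \<open>Separate, saturate, separate again. The saturation of a Borel set is analytic and still
  misses the invariant set \<open>Z'\<close>, so the process continues; the union of all the Borel
  sets is invariant because the saturation of each lies in the next.\<close>

lemma invariant_separation:
  assumes S: "equiv (space M) S" "S \<in> sets (M \<Otimes>\<^sub>M M)"
    and Z: "analytic_in T Z" "analytic_in T Z'" "Z \<inter> Z' = {}" and inv: "S `` Z' \<subseteq> Z'"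
  obtains C where "C \<in> sets M" "Z \<subseteq> C" "C \<inter> Z' = {}" "S `` C \<subseteq> C"
proof -
  have "sym S" using S(1) by (simp add: equiv_def)
  define P where "P C \<longleftrightarrow> C \<in> sets M \<and> Z \<subseteq> C \<and> C \<inter> Z' = {}" for C
  have "\<exists>C. P C" unfolding P_def using separation[OF Z] by metis
  moreover have "\<exists>C'. P C' \<and> S `` C \<subseteq> C'" if "P C" for C
  proof -
    have "analytic_in T (S `` C \<union> Z)"
      using that unfolding P_def
      by (intro analytic_in_Un[OF _ Z(1)] analytic_in_Image[OF sets_pair_imp_analytic[OF S(2)] sets_imp_analytic]) simp
    moreover have "(S `` C \<union> Z) \<inter> Z' = {}"
      using that inv Z(3) \<open>sym S\<close> unfolding P_def by (blast dest: symD)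
    ultimately obtain C' where "C' \<in> sets M" "S `` C \<union> Z \<subseteq> C'" "C' \<inter> Z' = {}"
      using separation Z(2) by metis
    then show ?thesis unfolding P_def by blast
  qed
  ultimately obtain f :: "nat \<Rightarrow> _" where f: "\<And>n. P (f n)" "\<And>n. S `` f n \<subseteq> f (Suc n)"
    using dependent_nat_choice[of "\<lambda>_. P" "\<lambda>_ C C'. S `` C \<subseteq> C'"] by metis
  have "(\<Union>n. f n) \<in> sets M" using f(1) by (auto simp: P_def)
  moreover have "Z \<subseteq> (\<Union>n. f n)" "(\<Union>n. f n) \<inter> Z' = {}" using f(1) by (auto simp: P_def)
  moreover have "S `` (\<Union>n. f n) \<subseteq> (\<Union>n. f n)" using f(2) by blast
  ultimately show ?thesis using that by blast
qed

lemma countable_point_separating: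
  obtains V :: "nat \<Rightarrow> 'a set" where "\<And>n. V n \<in> sets M"
    "\<And>x y. x \<in> space M \<Longrightarrow> y \<in> space M \<Longrightarrow> x \<noteq> y \<Longrightarrow> \<exists>n. x \<in> V n \<and> y \<notin> V n"
proof -
  obtain \<B> where \<B>: "countable \<B>" "\<And>V. V \<in> \<B> \<Longrightarrow> openin T V"
    "\<And>U x. openin T U \<Longrightarrow> x \<in> U \<Longrightarrow> \<exists>V\<in>\<B>. x \<in> V \<and> V \<subseteq> U"
    using second_countable unfolding second_countable_def by metis
  \<comment> \<open>The empty set is added so that there is something to enumerate even when the
    base is empty.\<close>
  define V where "V = from_nat_into (insert {} \<B>)"
  have ran: "range V = insert {} \<B>" unfolding V_def by (rule range_from_nat_into) (use \<B>(1) in auto)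
  have "V n \<in> sets M" for n
    using ran \<B>(2) openin_imp_sets by (metis insert_iff rangeI sets.empty_sets)
  moreover have "\<exists>n. x \<in> V n \<and> y \<notin> V n" if xy: "x \<in> space M" "y \<in> space M" "x \<noteq> y" for x y
  proof -
    obtain U U' where "openin T U" "x \<in> U" "y \<in> U'" "U \<inter> U' = {}"
      using Hausdorff xy topspace_eq unfolding Hausdorff_space_def disjnt_def by metis
    then have "y \<notin> U" by blast
    then obtain W where "W \<in> \<B>" "x \<in> W" "y \<notin> W"
      using \<B>(3)[OF \<open>openin T U\<close> \<open>x \<in> U\<close>] by blast
    moreover obtain n where "V n = W" using ran \<open>W \<in> \<B>\<close> by (metis imageE insertCI)
    ultimately show ?thesis by blast
  qed
  ultimately show ?thesis using that by blast
qed

text \<open>The first set of a separating sequence that contains exactly one of two points decides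
  which of them is the smaller one.\<close>

lemma measurable_orientation:
  obtains Or where "Or \<in> sets (M \<Otimes>\<^sub>M M)" "\<And>x y. (x, y) \<in> Or \<Longrightarrow> (y, x) \<notin> Or"
    "\<And>x y. x \<in> space M \<Longrightarrow> y \<in> space M \<Longrightarrow> x \<noteq> y \<Longrightarrow> (x, y) \<in> Or \<or> (y, x) \<in> Or"
proof -
  obtain V :: "nat \<Rightarrow> 'a set" where V: "\<And>n. V n \<in> sets M"
    "\<And>x y. x \<in> space M \<Longrightarrow> y \<in> space M \<Longrightarrow> x \<noteq> y \<Longrightarrow> \<exists>n. x \<in> V n \<and> y \<notin> V n"
    by (rule countable_point_separating) blast
  define differ where "differ n x y \<longleftrightarrow> (x \<in> V n) \<noteq> (y \<in> V n)" for n x y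
  define Or where "Or = {p \<in> space (M \<Otimes>\<^sub>M M). \<exists>n. fst p \<in> V n \<and> snd p \<notin> V n \<and>
    (\<forall>m\<in>{..<n}. fst p \<in> V m \<longleftrightarrow> snd p \<in> V m)}"
  have [measurable]: "V n \<in> sets M" for n by (rule V(1))
  have "Or \<in> sets (M \<Otimes>\<^sub>M M)" unfolding Or_def by measurable
  moreover have "(y, x) \<notin> Or" if xy: "(x, y) \<in> Or" for x y
  proof
    assume "(y, x) \<in> Or"
    then obtain m where m: "y \<in> V m" "x \<notin> V m" "\<And>k. k < m \<Longrightarrow> y \<in> V k \<longleftrightarrow> x \<in> V k"
      by (auto simp: Or_def)
    obtain n where n: "x \<in> V n" "y \<notin> V n" "\<And>k. k < n \<Longrightarrow> x \<in> V k \<longleftrightarrow> y \<in> V k"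
      using xy by (auto simp: Or_def)
    show False using m n by (cases m n rule: linorder_cases) auto
  qed
  moreover have "(x, y) \<in> Or \<or> (y, x) \<in> Or" if xy: "x \<in> space M" "y \<in> space M" "x \<noteq> y" for x y
  proof -
    define n where "n = (LEAST n. differ n x y)"
    obtain k where "x \<in> V k" "y \<notin> V k" using V(2)[OF xy] by blast
    then have "differ k x y" by (simp add: differ_def)
    then have n: "differ n x y" unfolding n_def by (rule LeastI)
    have least: "\<forall>m\<in>{..<n}. x \<in> V m \<longleftrightarrow> y \<in> V m"
      unfolding n_def differ_def by (auto dest: not_less_Least)
    show ?thesis
    proof (cases "x \<in> V n")
      case True
      then have "y \<notin> V n" using n by (simp add: differ_def)
      then have "(x, y) \<in> Or"
        unfolding Or_def using True least xy by (auto simp: space_pair_measure)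
      then show ?thesis ..
    next
      case False
      then have "y \<in> V n" using n by (simp add: differ_def)
      then have "(y, x) \<in> Or"
        unfolding Or_def using False least xy by (auto simp: space_pair_measure)
      then show ?thesis ..
    qed
  qed
  ultimately show ?thesis by (rule that)
qed

end

lemma standard_borel_polish:
  assumes "standard_borel M"
  obtains T where "polish_measurable_space M T"
  using assms unfolding standard_borel_def polish_measurable_space_def by blast

section \<open>Ergodicity, invariance of the measure, and atoms\<close>

locale polish_prob_space = polish_measurable_space + prob_space M
begin

text \<open>Suppose the measurable hull of the saturation of \<open>A\<close> missed a non-null set.
  An invariant Borel set containing the first saturation and disjoint from that of the missed set
  would have positive measure and a non-null complement, against ergodicity.\<close>

lemma ergodic_saturation_AE:
  assumes S: "equiv (space M) S" "S \<in> sets (M \<Otimes>\<^sub>M M)" and erg: "ergodic_rel M S"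
    and A: "A \<in> sets M" "emeasure M A \<noteq> 0"
  shows "AE x in M. \<exists>y\<in>A. (x, y) \<in> S"
proof -
  have S': "S \<subseteq> space M \<times> space M" "refl_on (space M) S" "sym S" "trans S" using S(1) by (auto simp: equiv_def)
  define Z where "Z = S `` A"
  have an: "analytic_in T (S `` B)" if "B \<in> sets M" for B
    using that S(2) by (intro analytic_in_Image sets_pair_imp_analytic sets_imp_analytic)
  have sat: "S `` (S `` B) \<subseteq> S `` B" for B
  proof -
    have "S `` (S `` B) = (S O S) `` B" by (rule relcomp_Image[symmetric])
    then show ?thesis using trans_O_subset[OF S'(4)] by (simp add: Image_mono)
  qed
  have sub: "B \<subseteq> S `` B" if "B \<in> sets M" for B
    using S'(2) sets.sets_into_space[OF that] by (auto simp: refl_on_def)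
  obtain B where B: "B \<in> sets M" "B \<subseteq> Z" "emeasure M B = outer_measure_of M Z"
    using analytic_in_inner_regular[OF metrizable an[OF A(1)] topspace_eq openin_imp_sets finite_measure_axioms]
    unfolding Z_def by metis
  have "Z \<subseteq> space M" using S'(1) by (auto simp: Z_def)
  then obtain E where E: "E \<in> sets M" "Z \<subseteq> E" "outer_measure_of M Z = emeasure M E"
    using outer_measure_of_attain by metis
  have "emeasure M (space M - E) = 0"
  proof (rule ccontr)
    assume F: "emeasure M (space M - E) \<noteq> 0"
    let ?F = "space M - E"
    have "Z \<inter> S `` ?F = {}"
      using E(2) symD[OF S'(3)] sat[of A] unfolding Z_def by blast
    then obtain C where C: "C \<in> sets M" "Z \<subseteq> C" "C \<inter> S `` ?F = {}" "S `` C \<subseteq> C"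
      using invariant_separation[OF S an[OF A(1)] an[of ?F]] sat E(1) unfolding Z_def by (metis sets.compl_sets)
    have "\<Union> ((\<lambda>x. S `` {x}) ` C) = C" using C(4) sub[OF C(1)] by blast
    moreover have "(\<lambda>x. S `` {x}) ` C \<subseteq> space M // S"
      using sets.sets_into_space[OF C(1)] by (auto simp: quotient_def)
    ultimately have "emeasure M C = 0 \<or> emeasure M C = 1"
      using erg C(1) unfolding ergodic_rel_def by metis
    moreover have "emeasure M A \<le> emeasure M C"
      using sub[OF A(1)] C(1,2) by (intro emeasure_mono) (auto simp: Z_def)
    ultimately have "emeasure M C = 1" using A(2) by auto
    then have "emeasure M (space M - C) = 0"
      using C(1) emeasure_compl[of C M] emeasure_space_1 by simp
    moreover have "?F \<subseteq> space M - C" using C(3) sub[of ?F] E(1) by blast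
    ultimately show False using F C(1) emeasure_mono[of ?F "space M - C" M] by auto
  qed
  then have "emeasure M E = 1" using E(1) emeasure_compl[of "space M - E" M] emeasure_space_1
    by (simp add: double_diff sets.sets_into_space)
  \<comment> \<open>The inner set \<open>B\<close> has the same measure as the hull \<open>E\<close>
    and so supplies the measurable null set that an almost-everywhere statement calls for.\<close>
  then have "emeasure M (space M - B) = 0"
    using B(1,3) E(3) emeasure_compl[of B M] emeasure_space_1 by simp
  then have "AE x in M. x \<in> B" using B(1) by (intro AE_I[of _ _ "space M - B"]) auto
  then show ?thesis
    using B(2) S'(3) by (elim eventually_mono) (auto simp: Z_def dest: symD)
qed

text \<open>Since the saturation of a null set need not be measurable, the claim concerns its
  measurable subsets. The pairs of \<open>S\<close> ending in \<open>N\<close> have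
  \<open>mu_R\<close> zero, hence \<open>mu_L\<close> zero, and every point of \<open>B\<close>
  starts such a pair.\<close>

lemma pmp_null_saturation:
  assumes pmp: "pmp M R" and S: "S \<subseteq> R" "S \<in> sets (M \<Otimes>\<^sub>M M)"
    and N: "N \<in> null_sets M" and B: "B \<in> sets M" "B \<subseteq> {x. \<exists>y\<in>N. (x, y) \<in> S}"
  shows "emeasure M B = 0"
proof -
  let ?S = "S \<inter> space M \<times> N"
  have sets: "?S \<in> sets (M \<Otimes>\<^sub>M M)" using S(2) N by auto
  have eq: "mu_L M ?S = mu_R M ?S"
    by (rule pmp[unfolded pmp_def, rule_format, OF sets]) (use S(1) in blast)
  have "AE y in M. emeasure (count_space UNIV) {x. (x, y) \<in> ?S} = (0 :: ennreal)"
    using AE_not_in[OF N] by (elim eventually_mono) auto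
  then have "mu_R M ?S = (\<integral>\<^sup>+ y. 0 \<partial>M)" unfolding mu_R_def by (rule nn_integral_cong_AE)
  then have "mu_L M ?S = 0" using eq by simp
  moreover have "(\<integral>\<^sup>+ x. indicator B x \<partial>M) \<le> mu_L M ?S"
    unfolding mu_L_def
  proof (rule nn_integral_mono)
    fix x assume "x \<in> space M"
    show "indicator B x \<le> emeasure (count_space UNIV) {y. (x, y) \<in> ?S}"
    proof (cases "x \<in> B")
      case True
      then obtain y where "y \<in> N" "(x, y) \<in> S" using B(2) by blast
      then have "{y} \<subseteq> {y. (x, y) \<in> ?S}" using \<open>x \<in> space M\<close> by auto
      then have "emeasure (count_space UNIV) {y} \<le> emeasure (count_space UNIV) {y. (x, y) \<in> ?S}"
        by (intro emeasure_mono) auto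
      then show ?thesis using True by simp
    qed simp
  qed
  ultimately show ?thesis using B(1) by simp
qed

text \<open>Otherwise each member of a point-separating sequence is null or co-null in
  \<open>A\<close>. Discarding all the null sides \<open>W n\<close> leaves at most one point, so
  \<open>A\<close> itself would be null.\<close>

lemma nonatomic_split:
  assumes points: "\<And>x. x \<in> space M \<Longrightarrow> emeasure M {x} = 0"
    and A: "A \<in> sets M" "emeasure M A \<noteq> 0"
  shows "\<exists>B\<in>sets M. B \<subseteq> A \<and> emeasure M B \<noteq> 0 \<and> emeasure M (A - B) \<noteq> 0"
proof (rule ccontr)
  assume "\<not> ?thesis"
  then have *: "emeasure M B = 0 \<or> emeasure M (A - B) = 0" if "B \<in> sets M" "B \<subseteq> A" for B
    using that by metis
  obtain V :: "nat \<Rightarrow> 'a set" where V: "\<And>n. V n \<in> sets M"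
    "\<And>x y. x \<in> space M \<Longrightarrow> y \<in> space M \<Longrightarrow> x \<noteq> y \<Longrightarrow> \<exists>n. x \<in> V n \<and> y \<notin> V n"
    by (rule countable_point_separating) blast
  define W where "W n = (if emeasure M (A \<inter> V n) = 0 then A \<inter> V n else A - V n)" for n
  have "W n \<in> null_sets M" for n
  proof -
    have "emeasure M (A \<inter> V n) = 0 \<or> emeasure M (A - A \<inter> V n) = 0" using V(1)[of n] A(1) by (intro *) auto
    moreover have "A - A \<inter> V n = A - V n" by blast
    ultimately show ?thesis using V(1)[of n] A(1) by (auto simp: W_def null_sets_def)
  qed
  then have N: "(\<Union>n. W n) \<in> null_sets M" by blast
  have eq: "x = y" if xy: "x \<in> A - (\<Union>n. W n)" "y \<in> A - (\<Union>n. W n)" for x y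
  proof (rule ccontr)
    assume "x \<noteq> y"
    then obtain n where "x \<in> V n" "y \<notin> V n"
      using V(2)[of x y] xy sets.sets_into_space[OF A(1)] by blast
    moreover have "x \<notin> W n" "y \<notin> W n" "x \<in> A" "y \<in> A" using xy by auto
    ultimately show False by (auto simp: W_def split: if_splits)
  qed
  have "emeasure M (A - (\<Union>n. W n)) = 0"
  proof (cases "A - (\<Union>n. W n) = {}")
    case False
    then obtain x where "A - (\<Union>n. W n) = {x}" using eq by blast
    moreover have "x \<in> space M" using calculation sets.sets_into_space[OF A(1)] by blast
    ultimately show ?thesis using points by simp
  qed (simp only: emeasure_empty)
  moreover have "emeasure M (A - (\<Union>n. W n)) = emeasure M A"
    using N A(1) by (rule emeasure_Diff_null_set)
  ultimately show False using A(2) by simp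
qed

text \<open>Repeated splitting yields a decreasing chain in which every step removes a non-null
  part; the removed parts form the sequence.\<close>

lemma nonatomic_disjoint_sequence:
  assumes points: "\<And>x. x \<in> space M \<Longrightarrow> emeasure M {x} = 0"
    and A: "A \<in> sets M" "emeasure M A \<noteq> 0"
  obtains D :: "nat \<Rightarrow> 'a set" where "\<And>n. D n \<in> sets M" "\<And>n. D n \<subseteq> A" "\<And>n. emeasure M (D n) \<noteq> 0"
    "\<And>m n. m \<noteq> n \<Longrightarrow> D m \<inter> D n = {}"
proof -
  define P where "P B \<longleftrightarrow> B \<in> sets M \<and> B \<subseteq> A \<and> emeasure M B \<noteq> 0" for B
  have "\<exists>B. P B" using A by (auto simp: P_def)
  moreover have "\<exists>B'. P B' \<and> B' \<subseteq> B \<and> emeasure M (B - B') \<noteq> 0" if "P B" for B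
    using nonatomic_split[OF points, of B] that unfolding P_def by blast
  ultimately have "\<exists>B. \<forall>n :: nat. P (B n) \<and> (B (Suc n) \<subseteq> B n \<and> emeasure M (B n - B (Suc n)) \<noteq> 0)"
    by (intro dependent_nat_choice) auto
  then obtain B :: "nat \<Rightarrow> _" where B: "\<And>n. P (B n)" "\<And>n. B (Suc n) \<subseteq> B n"
    "\<And>n. emeasure M (B n - B (Suc n)) \<noteq> 0"
    by metis
  have mono: "B n \<subseteq> B (Suc m)" if "m < n" for m n
    using lift_Suc_antimono_le[of B "Suc m" n, OF B(2)] that by simp
  show ?thesis
  proof
    show "B n - B (Suc n) \<in> sets M" "B n - B (Suc n) \<subseteq> A" for n
      using B(1)[of n] B(1)[of "Suc n"] by (auto simp: P_def)
    show "(B m - B (Suc m)) \<inter> (B n - B (Suc n)) = {}" if "m \<noteq> n" for m n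
      using that mono[of m n] mono[of n m] by (cases m n rule: linorder_cases) auto
  qed (rule B(3))
qed

text \<open>By ergodicity the \<open>S\<close>-class \<open>Z\<close> of an atom has measure one. A
  point of \<open>B\<close> in \<open>Z\<close> is \<open>R\<close>-related to a point outside
  \<open>Z\<close>, which is null; invariance applied to this single pair makes the point of
  \<open>B\<close> null as well. As \<open>Z\<close> is countable, \<open>B\<close> would be
  null.\<close>

lemma nonatomic_of_proper:
  assumes R: "R \<subseteq> space M \<times> space M" "pmp M R"
    and S: "equiv (space M) S" and erg: "ergodic_rel M S"
    and countable: "\<And>x. x \<in> space M \<Longrightarrow> countable (S `` {x})"
    and B: "B \<in> sets M" "emeasure M B \<noteq> 0" "\<And>x. x \<in> B \<Longrightarrow> \<exists>y. (x, y) \<in> R - S"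
    and p: "p \<in> space M"
  shows "emeasure M {p} = 0"
proof (rule ccontr)
  assume pos: "emeasure M {p} \<noteq> 0"
  define Z where "Z = S `` {p}"
  have Z_space: "Z \<subseteq> space M" and "p \<in> Z"
    using S p by (auto simp: Z_def equiv_def refl_on_def)
  have Z: "Z \<in> sets M"
    by (rule sets.countable) (use Z_space singleton_sets countable[OF p] in \<open>auto simp: Z_def\<close>)
  have "\<Union>{Z} \<in> sets M" "{Z} \<subseteq> space M // S" using Z p by (auto simp: Z_def quotient_def)
  then have "emeasure M Z = 0 \<or> emeasure M Z = 1"
    using erg[unfolded ergodic_rel_def, rule_format, of "{Z}"] by simp
  moreover have "emeasure M {p} \<le> emeasure M Z" using Z \<open>p \<in> Z\<close> by (intro emeasure_mono) auto
  ultimately have "emeasure M Z = 1" using pos by auto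
  then have null: "space M - Z \<in> null_sets M"
    using Z emeasure_compl[of Z M] emeasure_space_1 by (auto simp: null_sets_def)
  have "emeasure M {x} = 0" if x: "x \<in> B \<inter> Z" for x
  proof -
    obtain y where y: "(x, y) \<in> R" "(x, y) \<notin> S" using B(3) x by blast
    have x_sp: "x \<in> space M" and y_sp: "y \<in> space M" using y(1) R(1) by auto
    have "y \<notin> Z"
    proof
      assume "y \<in> Z"
      then have "(p, x) \<in> S" "(p, y) \<in> S" using x by (auto simp: Z_def)
      moreover have "sym S" "trans S" using S by (simp_all add: equiv_def)
      ultimately have "(x, y) \<in> S" using symD transD by metis
      then show False using y(2) by blast
    qed
    have "{x} \<times> {y} \<in> sets (M \<Otimes>\<^sub>M M)" using singleton_sets[OF x_sp] singleton_sets[OF y_sp] by (rule pair_measureI)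
    then have "mu_L M {(x, y)} = mu_R M {(x, y)}" using R(2) y(1) by (auto simp: pmp_def)
    moreover have "mu_L M {(x, y)} = emeasure M {x}"
    proof -
      have "emeasure (count_space UNIV) {y'. (x', y') \<in> {(x, y)}} = indicator {x} x'" for x'
        by (cases "x' = x") auto
      then show ?thesis unfolding mu_L_def using singleton_sets[OF x_sp] by simp
    qed
    moreover have "mu_R M {(x, y)} = emeasure M {y}"
    proof -
      have "emeasure (count_space UNIV) {x'. (x', y') \<in> {(x, y)}} = indicator {y} y'" for y'
        by (cases "y' = y") auto
      then show ?thesis unfolding mu_R_def using singleton_sets[OF y_sp] by simp
    qed
    moreover have "emeasure M {y} = 0"
      using null \<open>y \<notin> Z\<close> y_sp singleton_sets[OF y_sp] null_sets_subset[OF null, of "{y}"] by auto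
    ultimately show ?thesis by simp
  qed
  moreover have "countable (B \<inter> Z)" using countable[OF p] by (auto simp: Z_def intro: countable_subset)
  moreover have sp: "B \<inter> Z \<subseteq> space M" using Z_space by blast
  ultimately have "(\<Union>x\<in>B \<inter> Z. {x}) \<in> null_sets M"
    using singleton_sets by (intro null_sets_UN') (auto simp: null_sets_def)
  then have "(\<Union>x\<in>B \<inter> Z. {x}) \<union> (space M - Z) \<in> null_sets M" using null by (rule null_sets.Un)
  moreover have "B \<subseteq> (\<Union>x\<in>B \<inter> Z. {x}) \<union> (space M - Z)" using sets.sets_into_space[OF B(1)] by auto
  ultimately have "B \<in> null_sets M" using B(1) null_sets_subset by blast
  then show False using B(2) by auto
qed

text \<open>The initial points of a given orientation may form a null set; then the reversed
  orientation is taken. Both cannot fail: the two sets of initial points cover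
  \<open>Domain F\<close>, and a null set cannot have the non-null \<open>B\<close> inside its
  saturation.\<close>

lemma oriented_edges_positive:
  assumes pmp: "pmp M R" and S: "S \<subseteq> R" "S \<in> sets (M \<Otimes>\<^sub>M M)"
    and F: "F \<in> sets (M \<Otimes>\<^sub>M M)" "F \<subseteq> space M \<times> space M" "\<And>x. (x, x) \<notin> F"
    and B: "B \<in> sets M" "emeasure M B \<noteq> 0" "B \<subseteq> {x. \<exists>y\<in>Domain F. (x, y) \<in> S}"
  obtains Or A where "Or \<in> sets (M \<Otimes>\<^sub>M M)" "\<And>x y. (x, y) \<in> Or \<Longrightarrow> (y, x) \<notin> Or"
    "\<And>x y. x \<in> space M \<Longrightarrow> y \<in> space M \<Longrightarrow> x \<noteq> y \<Longrightarrow> (x, y) \<in> Or \<or> (y, x) \<in> Or"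
    "A \<in> sets M" "emeasure M A \<noteq> 0" "A \<subseteq> Domain (F \<inter> Or)"
proof -
  obtain Or where Or: "Or \<in> sets (M \<Otimes>\<^sub>M M)" "\<And>x y. (x, y) \<in> Or \<Longrightarrow> (y, x) \<notin> Or"
    "\<And>x y. x \<in> space M \<Longrightarrow> y \<in> space M \<Longrightarrow> x \<noteq> y \<Longrightarrow> (x, y) \<in> Or \<or> (y, x) \<in> Or"
    by (rule measurable_orientation) blast
  define Or' where "Or' = (\<lambda>(x, y). (y, x)) -` Or \<inter> space (M \<Otimes>\<^sub>M M)"
  have Or'_sets: "Or' \<in> sets (M \<Otimes>\<^sub>M M)"
    unfolding Or'_def using measurable_pair_swap' Or(1) by (rule measurable_sets)
  have Or'_iff: "(x, y) \<in> Or' \<longleftrightarrow> (y, x) \<in> Or" for x y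
    using sets.sets_into_space[OF Or(1)] by (auto simp: Or'_def space_pair_measure)
  have positive: "\<exists>A\<in>sets M. emeasure M A \<noteq> 0 \<and> A \<subseteq> Domain (F \<inter> P)"
    if P: "P \<in> sets (M \<Otimes>\<^sub>M M)" "outer_measure_of M (Domain (F \<inter> P)) \<noteq> 0" for P
  proof -
    have "analytic_in T (Domain (F \<inter> P))"
      using F(1) P(1) by (intro analytic_in_Domain sets_pair_imp_analytic sets.Int)
    then show ?thesis
      using analytic_in_inner_regular[OF metrizable _ topspace_eq openin_imp_sets finite_measure_axioms] P(2)
      by metis
  qed
  have null: "\<exists>N\<in>null_sets M. Domain (F \<inter> P) \<subseteq> N" if "outer_measure_of M (Domain (F \<inter> P)) = 0" for P
  proof -
    have "Domain (F \<inter> P) \<subseteq> space M" using F(2) by auto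
    then obtain N where "N \<in> sets M" "Domain (F \<inter> P) \<subseteq> N" "outer_measure_of M (Domain (F \<inter> P)) = emeasure M N"
      using outer_measure_of_attain by metis
    then show ?thesis using that by (auto simp: null_sets_def)
  qed
  have "outer_measure_of M (Domain (F \<inter> Or)) \<noteq> 0 \<or> outer_measure_of M (Domain (F \<inter> Or')) \<noteq> 0"
  proof (rule ccontr)
    assume "\<not> ?thesis"
    then obtain N N' where N: "N \<in> null_sets M" "N' \<in> null_sets M"
      "Domain (F \<inter> Or) \<subseteq> N" "Domain (F \<inter> Or') \<subseteq> N'"
      using null by metis
    have "Domain F \<subseteq> N \<union> N'"
    proof
      fix x assume "x \<in> Domain F"
      then obtain y where "(x, y) \<in> F" by blast
      moreover have "x \<noteq> y" using calculation F(3) by blast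
      moreover have "x \<in> space M" "y \<in> space M" using calculation F(2) by auto
      ultimately have "(x, y) \<in> Or \<or> (x, y) \<in> Or'" using Or(3) Or'_iff by blast
      with \<open>(x, y) \<in> F\<close> N(3,4) show "x \<in> N \<union> N'" by blast
    qed
    then have "B \<subseteq> {x. \<exists>y\<in>N \<union> N'. (x, y) \<in> S}" using B(3) by blast
    then show False using pmp_null_saturation[OF pmp S null_sets.Un[OF N(1,2)] B(1)] B(2) by blast
  qed
  then show ?thesis
  proof
    assume "outer_measure_of M (Domain (F \<inter> Or)) \<noteq> 0"
    then obtain A where "A \<in> sets M" "emeasure M A \<noteq> 0" "A \<subseteq> Domain (F \<inter> Or)"
      using positive[OF Or(1)] by blast
    then show ?thesis by (intro that[of Or A] Or)
  next
    assume "outer_measure_of M (Domain (F \<inter> Or')) \<noteq> 0"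
    then obtain A where A: "A \<in> sets M" "emeasure M A \<noteq> 0" "A \<subseteq> Domain (F \<inter> Or')"
      using positive[OF Or'_sets] by blast
    show ?thesis
    proof (rule that[of Or' A])
      show "(y, x) \<notin> Or'" if "(x, y) \<in> Or'" for x y
        using that Or(2)[of y x] by (simp add: Or'_iff)
      show "(x, y) \<in> Or' \<or> (y, x) \<in> Or'" if "x \<in> space M" "y \<in> space M" "x \<noteq> y" for x y
        using Or(3)[OF that] by (auto simp: Or'_iff)
    qed (use A Or'_sets in simp_all)
  qed
qed

end

section \<open>Kernels of cocycles into countable groups\<close>

lemma standard_borel_count_space: "countable A \<Longrightarrow> standard_borel (count_space A)"
  unfolding standard_borel_def
proof (intro exI[of _ "discrete_topology A"] conjI)
  assume "countable A"
  then show "second_countable (discrete_topology A)" by (simp add: second_countable_discrete_topology)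
  have "sigma_sets A (Pow A) = Pow A" by (metis sigma_algebra.sigma_sets_eq sigma_algebra_Pow)
  then show "sets (count_space A) = sigma_sets (space (count_space A)) {U. openin (discrete_topology A) U}"
    by (simp add: Pow_def)
qed (auto simp: completely_metrizable_space_discrete_topology)

lemma borel_group_hom_closed:
  assumes hom: "borel_group_hom M R G \<theta>" and R: "R \<in> sets (M \<Otimes>\<^sub>M M)" and p: "p \<in> R"
  shows "\<theta> p \<in> carrier G"
proof -
  have "space (restrict_space (M \<Otimes>\<^sub>M M) R) = R"
    using sets.sets_into_space[OF R] by (auto simp: space_restrict_space)
  then show ?thesis
    using hom p unfolding borel_group_hom_def by (auto dest!: measurable_space)
qed

text \<open>A group is a groupoid with a single unit. The injection \<open>f\<close> moves it to a
  countable discrete set of reals, the arrow type that \<open>normal_subrel\<close>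
  prescribes.\<close>

lemma kernel_normal_subrel:
  fixes G :: "('g, 'm) monoid_scheme"
  assumes "group G" and countable: "countable (carrier G)" and hom: "borel_group_hom M R G \<theta>"
    and R: "equiv (space M) R" "R \<in> sets (M \<Otimes>\<^sub>M M)"
    and N: "N = {p \<in> R. \<theta> p = \<one>\<^bsub>G\<^esub>}" "subrel M N R"
  shows "normal_subrel M N R"
proof -
  interpret group G by (rule assms(1))
  define f :: "'g \<Rightarrow> real" where "f g = real (to_nat_on (carrier G) g)" for g
  have inj: "inj_on f (carrier G)"
    using inj_on_to_nat_on[OF countable] by (auto simp: f_def inj_on_def)
  let ?A = "f ` carrier G" and ?i = "the_inv_into (carrier G) f"
  have i [simp]: "?i (f g) = g" if "g \<in> carrier G" for g by (rule the_inv_into_f_f[OF inj that])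
  have cA: "countable ?A" using countable by simp
  define \<G> :: "real groupoid_data" where
    "\<G> = \<lparr>arrows = count_space ?A, src = (\<lambda>_. f \<one>\<^bsub>G\<^esub>), rng = (\<lambda>_. f \<one>\<^bsub>G\<^esub>),
          mul = (\<lambda>a b. f (?i a \<otimes>\<^bsub>G\<^esub> ?i b)), ginv = (\<lambda>a. f (inv\<^bsub>G\<^esub> ?i a))\<rparr>"
  have comp: "composable \<G> = ?A \<times> ?A" by (auto simp: composable_def \<G>_def)
  have units: "units \<G> = {f \<one>\<^bsub>G\<^esub>}" by (auto simp: units_def \<G>_def)
  have "discrete_borel_groupoid \<G>"
  proof
    show "(\<lambda>(g, h). mul \<G> g h) \<in> restrict_space (arrows \<G> \<Otimes>\<^sub>M arrows \<G>) (composable \<G>) \<rightarrow>\<^sub>M arrows \<G>"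
      unfolding comp by (auto simp: \<G>_def pair_measure_countable[OF cA cA] restrict_count_space)
    show "countable {g \<in> space (arrows \<G>). src \<G> g = u}" for u
      using cA by (auto simp: \<G>_def)
  qed (auto simp: \<G>_def comp[unfolded \<G>_def] standard_borel_count_space cA m_assoc)
  moreover have \<theta>: "\<theta> p \<in> carrier G" if "p \<in> R" for p using borel_group_hom_closed[OF hom R(2) that] .
  have "borel_groupoid_hom M R \<G> (\<lambda>p. f (\<theta> p))"
    unfolding borel_groupoid_hom_def
  proof (intro conjI allI impI)
    have "f \<in> count_space (carrier G) \<rightarrow>\<^sub>M count_space ?A" by simp
    then show "(\<lambda>p. f (\<theta> p)) \<in> restrict_space (M \<Otimes>\<^sub>M M) R \<rightarrow>\<^sub>M arrows \<G>"
      using measurable_compose[of \<theta> "restrict_space (M \<Otimes>\<^sub>M M) R" "count_space (carrier G)" f "count_space ?A"] hom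
      by (simp add: borel_group_hom_def \<G>_def)
    fix x y z assume *: "(x, y) \<in> R" "(y, z) \<in> R"
    then show "(f (\<theta> (x, y)), f (\<theta> (y, z))) \<in> composable \<G>" by (simp add: comp \<theta>)
    show "mul \<G> (f (\<theta> (x, y))) (f (\<theta> (y, z))) = f (\<theta> (x, z))"
      using hom * unfolding borel_group_hom_def \<G>_def by (simp add: \<theta>)
  qed
  moreover have "groupoid_ker R \<G> (\<lambda>p. f (\<theta> p)) = N"
    unfolding groupoid_ker_def units N(1) using inj_on_eq_iff[OF inj] \<theta> by auto
  then have "rel_eq_ae M N (groupoid_ker R \<G> (\<lambda>p. f (\<theta> p)))"
    by (simp add: rel_eq_ae_def mu_L_def)
  ultimately show ?thesis using N(2) unfolding normal_subrel_def by blast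
qed

text \<open>A union of \<open>N\<close>-classes is also a union of \<open>S\<close>-classes, so the
  larger relation has fewer sets to test.\<close>

lemma ergodic_rel_mono:
  assumes "ergodic_rel M S" "S \<subseteq> N" "equiv (space M) S" "equiv (space M) N"
  shows "ergodic_rel M N"
  unfolding ergodic_rel_def
proof (intro allI impI)
  fix C assume C: "C \<subseteq> space M // N" "\<Union>C \<in> sets M"
  have sub: "S `` {x} \<subseteq> \<Union>C" if "x \<in> \<Union>C" for x
  proof -
    obtain K where K: "K \<in> C" "x \<in> K" using \<open>x \<in> \<Union>C\<close> by blast
    then have "N `` {x} \<subseteq> K"
      using C(1) in_quotient_imp_closed[OF assms(4), of K] by (auto simp: quotient_def)
    then show ?thesis using K assms(2) by blast
  qed
  have sp: "\<Union>C \<subseteq> space M" using sets.sets_into_space[OF C(2)] .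
  then have "x \<in> S `` {x}" if "x \<in> \<Union>C" for x
    using that assms(3) by (auto simp: equiv_def refl_on_def)
  then have "\<Union> ((\<lambda>x. S `` {x}) ` \<Union>C) = \<Union>C" using sub by blast
  moreover have "(\<lambda>x. S `` {x}) ` \<Union>C \<subseteq> space M // S" using sp by (auto simp: quotient_def)
  ultimately show "emeasure M (\<Union>C) = 0 \<or> emeasure M (\<Union>C) = 1"
    using assms(1) C(2) unfolding ergodic_rel_def by metis
qed

text \<open>The integrand is not known to be measurable here. The integral is a supremum over simple
  functions below it, so a nonzero value yields a simple minorant with nonzero integral, and
  \<open>B\<close> is its support.\<close>

lemma mu_L_nonzero_imp_set:
  assumes "mu_L M P \<noteq> 0"
  obtains B where "B \<in> sets M" "emeasure M B \<noteq> 0" "\<And>x. x \<in> B \<Longrightarrow> \<exists>y. (x, y) \<in> P"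
proof -
  let ?f = "\<lambda>x. emeasure (count_space UNIV) {y. (x, y) \<in> P}"
  have "\<exists>g. simple_function M g \<and> g \<le> ?f \<and> integral\<^sup>S M g \<noteq> 0"
  proof (rule ccontr)
    assume "\<not> ?thesis"
    then have "(SUP g\<in>{g. simple_function M g \<and> g \<le> ?f}. integral\<^sup>S M g) \<le> 0"
      by (intro SUP_least) auto
    then show False using assms unfolding mu_L_def nn_integral_def by simp
  qed
  then obtain g where g: "simple_function M g" "\<And>x. g x \<le> ?f x" "integral\<^sup>S M g \<noteq> 0"
    by (auto simp: le_fun_def)
  define B where "B = {x \<in> space M. g x \<noteq> 0}"
  have "g \<in> borel_measurable M" using g(1) by (rule borel_measurable_simple_function)
  then have "B \<in> sets M" unfolding B_def by measurable
  moreover have "emeasure M B \<noteq> 0"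
  proof
    assume "emeasure M B = 0"
    then have "AE x in M. g x = 0"
      using \<open>B \<in> sets M\<close> by (intro AE_I[of _ _ B]) (auto simp: B_def)
    then have "integral\<^sup>N M g = (\<integral>\<^sup>+ x. 0 \<partial>M)" by (rule nn_integral_cong_AE)
    then have "integral\<^sup>N M g = 0" by simp
    then show False using g(1,3) nn_integral_eq_simple_integral by metis
  qed
  moreover have "\<exists>y. (x, y) \<in> P" if "x \<in> B" for x
  proof (rule ccontr)
    assume "\<nexists>y. (x, y) \<in> P"
    then have "g x \<le> 0" using g(2)[of x] by simp
    then show False using \<open>x \<in> B\<close> by (simp add: B_def)
  qed
  ultimately show ?thesis using that by blast
qed

section \<open>Cocycles from edge weights\<close>

text \<open>Walks are sorted by their number of edges: if the first edge has weight h, the rest must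
  have weight \<open>inv h \<otimes> g\<close>, which expresses each level
  \<open>L (Suc n) g\<close> as a countable union of compositions. The intersection with
  \<open>space M \<times> space M\<close> removes the one-point walks outside the space.\<close>

lemma (in polish_measurable_space) analytic_connected_weight:
  fixes G :: "('g, 'm) monoid_scheme"
  assumes forest: "weighted_forest G E w" and E: "E \<subseteq> space M \<times> space M"
    and countable: "countable (carrier G)"
    and w_sets: "\<And>g. g \<in> carrier G \<Longrightarrow> {p \<in> E. w p = g} \<in> sets (M \<Otimes>\<^sub>M M)"
    and g: "g \<in> carrier G"
  shows "analytic_in (prod_topology T T) (weighted_forest.connected_weight G E w g \<inter> space M \<times> space M)"
proof -
  interpret weighted_forest G E w by (rule forest)
  let ?T2 = "prod_topology T T"
  define L where "L n g = {(x, y). x \<in> space M \<and>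
    (\<exists>xs. length xs = Suc n \<and> hd xs = x \<and> last xs = y \<and> walk xs \<and> walk_weight G w xs = g)}" for n g
  have L_0: "L 0 g = (if g = \<one>\<^bsub>G\<^esub> then Id_on (space M) else {})" for g
  proof -
    have "(\<exists>xs. length xs = Suc 0 \<and> hd xs = x \<and> last xs = y \<and> walk xs \<and> walk_weight G w xs = g) \<longleftrightarrow>
        x = y \<and> g = \<one>\<^bsub>G\<^esub>" for x y
      by (auto simp: length_Suc_conv)
    then show ?thesis by (auto simp: L_def)
  qed
  have L_Suc: "L (Suc n) g = (\<Union>h\<in>carrier G. {p \<in> E. w p = h} O L n (inv\<^bsub>G\<^esub> h \<otimes>\<^bsub>G\<^esub> g))"
    if g: "g \<in> carrier G" for n g
  proof (intro subset_antisym subrelI)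
    fix x z assume "(x, z) \<in> L (Suc n) g"
    then obtain xs where xs: "length xs = Suc (Suc n)" "hd xs = x" "last xs = z" "walk xs" "walk_weight G w xs = g"
      by (auto simp: L_def)
    then obtain y ys where ys: "xs = x # y # ys" by (auto simp: length_Suc_conv)
    have xy: "(x, y) \<in> E" "walk (y # ys)" using xs(4) ys by auto
    let ?h = "w (x, y)" and ?a = "walk_weight G w (y # ys)"
    have closed: "?h \<in> carrier G" "?a \<in> carrier G" using weight_closed walk_weight_closed xy by auto
    have "g = ?h \<otimes>\<^bsub>G\<^esub> ?a" using xs(5) ys by simp
    then have "?a = inv\<^bsub>G\<^esub> ?h \<otimes>\<^bsub>G\<^esub> g" using closed by (simp add: m_assoc[symmetric])
    then have "(y, z) \<in> L n (inv\<^bsub>G\<^esub> ?h \<otimes>\<^bsub>G\<^esub> g)"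
      unfolding L_def using xs xy ys E by (auto intro!: exI[of _ "y # ys"])
    then show "(x, z) \<in> (\<Union>h\<in>carrier G. {p \<in> E. w p = h} O L n (inv\<^bsub>G\<^esub> h \<otimes>\<^bsub>G\<^esub> g))"
      using closed(1) xy(1) by blast
  next
    fix x z assume "(x, z) \<in> (\<Union>h\<in>carrier G. {p \<in> E. w p = h} O L n (inv\<^bsub>G\<^esub> h \<otimes>\<^bsub>G\<^esub> g))"
    then obtain y xs where xy: "(x, y) \<in> E" and
      xs: "length xs = Suc n" "hd xs = y" "last xs = z" "walk xs" "walk_weight G w xs = inv\<^bsub>G\<^esub> w (x, y) \<otimes>\<^bsub>G\<^esub> g"
      by (auto simp: L_def)
    then obtain ys where ys: "xs = y # ys" by (auto simp: length_Suc_conv)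
    have "w (x, y) \<otimes>\<^bsub>G\<^esub> (inv\<^bsub>G\<^esub> w (x, y) \<otimes>\<^bsub>G\<^esub> g) = g"
      using weight_closed[OF xy] g by (simp add: m_assoc[symmetric])
    then show "(x, z) \<in> L (Suc n) g"
      unfolding L_def using xs xy ys E by (auto intro!: exI[of _ "x # y # ys"])
  qed
  have L: "analytic_in ?T2 (L n g)" if "g \<in> carrier G" for n g
    using that
  proof (induction n arbitrary: g)
    case 0
    have "analytic_in ?T2 ((\<lambda>x. (x, x)) ` space M)"
      by (rule analytic_in_image[OF sets_imp_analytic[OF sets.top]]) (simp add: continuous_map_paired)
    moreover have "(\<lambda>x. (x, x)) ` space M = Id_on (space M)" by auto
    ultimately show ?case by (simp add: L_0)
  next
    case (Suc n)
    then show ?case unfolding L_Suc[OF Suc.prems]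
      by (intro analytic_in_countable_UN[OF countable]
          analytic_in_relcomp[OF Hausdorff sets_pair_imp_analytic[OF w_sets] Suc.IH]) auto
  qed
  have "connected_weight g \<inter> space M \<times> space M = (\<Union>n. L n g)"
  proof (intro subset_antisym subrelI)
    fix x y assume "(x, y) \<in> connected_weight g \<inter> space M \<times> space M"
    then obtain xs where "xs \<noteq> []" "hd xs = x" "last xs = y" "walk xs" "walk_weight G w xs = g" "x \<in> space M"
      by (auto simp: connected_weight_def)
    then have "(x, y) \<in> L (length xs - 1) g" by (auto simp: L_def)
    then show "(x, y) \<in> (\<Union>n. L n g)" by blast
  next
    fix x y assume "(x, y) \<in> (\<Union>n. L n g)"
    then obtain n where n: "(x, y) \<in> L n g" by blast
    then obtain xs where "length xs = Suc n" "hd xs = x" "last xs = y" "walk xs" "walk_weight G w xs = g"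
      by (auto simp: L_def)
    moreover have "xs \<noteq> []" using calculation(1) by auto
    ultimately have "(x, y) \<in> connected_weight g" using connected_weightI[of xs g] by auto
    moreover have "(x, y) \<in> space M \<times> space M"
      using analytic_in_subset_topspace[OF L[OF g]] n by (auto simp: topspace_eq)
    ultimately show "(x, y) \<in> connected_weight g \<inter> space M \<times> space M" by blast
  qed
  then show ?thesis using analytic_in_UN[of ?T2 "\<lambda>n. L n g", OF L[OF g]] by simp
qed

lemma (in weighted_forest) rtrancl_imp_connected_weight:
  assumes "(x, y) \<in> E\<^sup>*"
  obtains g where "g \<in> carrier G" "(x, y) \<in> connected_weight g"
  using assms
proof (induction arbitrary: thesis rule: rtrancl_induct)
  case base
  then show ?case using connected_weight_refl by blast
next
  case (step y z)
  then show ?case using connected_weight_trans connected_weight_edge connected_weight_closed by metis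
qed

lemma (in weighted_forest) rtrancl_imp_connected_weight_one:
  assumes "(x, y) \<in> E'\<^sup>*" "E' \<subseteq> E" "\<And>p. p \<in> E' \<Longrightarrow> w p = \<one>"
  shows "(x, y) \<in> connected_weight \<one>"
  using assms(1)
proof (induction rule: rtrancl_induct)
  case base
  show ?case by (rule connected_weight_refl)
next
  case (step y z)
  then have "(y, z) \<in> connected_weight \<one>" using connected_weight_edge[of y z] assms(2,3) by auto
  with step.IH show ?case using connected_weight_trans[of x y \<one> z \<one>] by simp
qed

lemma (in polish_prob_space) forest_cocycle:
  fixes G :: "('g, 'm) monoid_scheme"
  assumes forest: "weighted_forest G E w" and countable: "countable (carrier G)"
    and w_sets: "\<And>g. g \<in> carrier G \<Longrightarrow> {p \<in> E. w p = g} \<in> sets (M \<Otimes>\<^sub>M M)"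
    and R: "equiv (space M) R" "R \<in> sets (M \<Otimes>\<^sub>M M)" and E: "E \<subseteq> R" "R \<subseteq> E\<^sup>*"
  obtains \<theta> where "borel_group_hom M R G \<theta>"
    "\<And>p. p \<in> R \<Longrightarrow> p \<in> weighted_forest.connected_weight G E w (\<theta> p)"
    "\<And>g. {p \<in> R. \<theta> p = g} \<in> sets (M \<Otimes>\<^sub>M M)"
proof -
  interpret weighted_forest G E w by (rule forest)
  have R_sub: "R \<subseteq> space M \<times> space M" using R(1) by (auto simp: equiv_def)
  define \<theta> where "\<theta> p = (THE g. p \<in> connected_weight g)" for p
  have unique: "\<theta> p = g" if "p \<in> connected_weight g" for p g
    unfolding \<theta>_def using that connected_weight_unique by (cases p) (blast intro: the_equality)
  have ex: "\<exists>g\<in>carrier G. p \<in> connected_weight g" if "p \<in> R" for p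
    using that E(2) by (cases p) (blast elim: rtrancl_imp_connected_weight)
  have mem: "p \<in> connected_weight (\<theta> p)" "\<theta> p \<in> carrier G" if "p \<in> R" for p
    using ex[OF that] unique by metis+
  have sets: "connected_weight g \<inter> R \<in> sets (M \<Otimes>\<^sub>M M)" if g: "g \<in> carrier G" for g
  proof (rule analytic_partition_sets[OF countable _ _ _ g])
    show "analytic_in (prod_topology T T) (connected_weight h \<inter> R)" if "h \<in> carrier G" for h
    proof -
      have "analytic_in (prod_topology T T) ((connected_weight h \<inter> space M \<times> space M) \<inter> R)"
        using that E(1) R_sub R(2) Hausdorff
        by (intro analytic_in_Int analytic_connected_weight[OF forest _ countable w_sets] sets_pair_imp_analytic)
          (auto simp: Hausdorff_space_prod_topology)
      moreover have "(connected_weight h \<inter> space M \<times> space M) \<inter> R = connected_weight h \<inter> R" using R_sub by blast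
      ultimately show ?thesis by simp
    qed
    show "disjoint_family_on (\<lambda>g. connected_weight g \<inter> R) (carrier G)"
      using connected_weight_unique by (force simp: disjoint_family_on_def)
    have "(\<Union>g\<in>carrier G. connected_weight g \<inter> R) = R" using ex by blast
    then show "(\<Union>g\<in>carrier G. connected_weight g \<inter> R) \<in> sets (M \<Otimes>\<^sub>M M)" using R(2) by simp
  qed
  have fibre: "{p \<in> R. \<theta> p = g} = connected_weight g \<inter> R" for g using mem unique by blast
  have fibre_sets: "{p \<in> R. \<theta> p = g} \<in> sets (M \<Otimes>\<^sub>M M)" for g
  proof (cases "g \<in> carrier G")
    case False
    then have "{p \<in> R. \<theta> p = g} = {}" using mem(2) by auto
    then show ?thesis by (simp only: sets.empty_sets)
  qed (use sets fibre in simp)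
  have space_R: "space (restrict_space (M \<Otimes>\<^sub>M M) R) = R"
    using R_sub by (auto simp: space_restrict_space space_pair_measure)
  have "\<theta> \<in> restrict_space (M \<Otimes>\<^sub>M M) R \<rightarrow>\<^sub>M count_space (carrier G)"
    unfolding measurable_count_space_eq_countable[OF countable] space_R
  proof (intro conjI ballI funcsetI)
    show "\<theta> p \<in> carrier G" if "p \<in> R" for p using mem(2)[OF that] .
    fix g
    have "\<theta> -` {g} \<inter> R = {p \<in> R. \<theta> p = g}" by auto
    then show "\<theta> -` {g} \<inter> R \<in> sets (restrict_space (M \<Otimes>\<^sub>M M) R)"
      using fibre_sets[of g] R(2) by (simp add: sets_restrict_space_iff)
  qed
  moreover have "\<theta> (x, y) \<otimes>\<^bsub>G\<^esub> \<theta> (y, z) = \<theta> (x, z)" if "(x, y) \<in> R" "(y, z) \<in> R" for x y z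
    using connected_weight_trans[OF mem(1)[OF that(1)] mem(1)[OF that(2)]] by (simp add: unique)
  ultimately show ?thesis using that mem(1) fibre_sets unfolding borel_group_hom_def by blast
qed

lemma (in polish_prob_space) cocycle_of_oriented_edges:
  fixes G :: "('g, 'm) monoid_scheme"
  assumes "group G" and countable: "countable (carrier G)"
    and R: "equiv (space M) R" "R \<in> sets (M \<Otimes>\<^sub>M M)" and E: "treeing M R E"
    and S: "equiv (space M) S" "S \<in> sets (M \<Otimes>\<^sub>M M)" and E': "treeing M S E'" "E' \<subseteq> E"
    and Or: "Or \<in> sets (M \<Otimes>\<^sub>M M)" "\<And>x y. (x, y) \<in> Or \<Longrightarrow> (y, x) \<notin> Or"
      "\<And>x y. x \<in> space M \<Longrightarrow> y \<in> space M \<Longrightarrow> x \<noteq> y \<Longrightarrow> (x, y) \<in> Or \<or> (y, x) \<in> Or"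
    and k: "\<And>x. k x \<in> carrier G" "\<And>g. {x \<in> space M. k x = g} \<in> sets M"
  obtains \<theta> where "borel_group_hom M R G \<theta>" "\<And>g. {p \<in> R. \<theta> p = g} \<in> sets (M \<Otimes>\<^sub>M M)"
    "\<And>p. p \<in> S \<Longrightarrow> \<theta> p = \<one>\<^bsub>G\<^esub>" "\<And>x y. (x, y) \<in> (E - S) \<inter> Or \<Longrightarrow> \<theta> (x, y) = k x"
proof -
  interpret group G by (rule assms(1))
  have E_facts: "E \<in> sets (M \<Otimes>\<^sub>M M)" "sym E" "E \<subseteq> R"
    using E by (simp_all add: treeing_def graphing_def)
  have "E' \<subseteq> S" using E'(1) by (simp add: treeing_def graphing_def)
  have R_sub: "R \<subseteq> space M \<times> space M" using R(1) by (auto simp: equiv_def)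
  have "sym S" using S(1) by (simp add: equiv_def)
  \<comment> \<open>An edge traversed against the orientation gets the inverse of the label at its
    second entry, which is the initial point of the reversed edge. \<open>Or\<close> contains
    exactly one of the two directions, which yields \<open>weight_inv\<close>.\<close>
  define w where "w p = (if p \<in> S then \<one>\<^bsub>G\<^esub> else if p \<in> Or then k (fst p) else inv\<^bsub>G\<^esub> k (snd p))" for p
  have forest: "weighted_forest G E w"
  proof
    show "sym E" by fact
    show "(x, x) \<notin> E" for x using treeing_imp_no_cycle(1)[OF R(1) E] .
    show "\<exists>i<length vs. (vs ! i, vs ! (Suc i mod length vs)) \<notin> E" if "3 \<le> length vs" "distinct vs" for vs
      using treeing_imp_no_cycle(2)[OF R(1) E that] .
    show "w p \<in> carrier G" for p by (simp add: w_def k(1))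
    show "w (y, x) = inv\<^bsub>G\<^esub> w (x, y)" if "(x, y) \<in> E" for x y
    proof (cases "(x, y) \<in> S")
      case True
      then have "(y, x) \<in> S" using \<open>sym S\<close> by (simp add: symD)
      with True show ?thesis by (simp add: w_def)
    next
      case False
      then have "(y, x) \<notin> S" using \<open>sym S\<close> by (auto dest: symD)
      moreover have "x \<noteq> y" using that treeing_imp_no_cycle(1)[OF R(1) E] by blast
      moreover have "x \<in> space M" "y \<in> space M" using that E_facts(3) R_sub by auto
      ultimately show ?thesis
        using False Or(2)[of x y] Or(3)[of x y] k(1) by (cases "(x, y) \<in> Or") (auto simp: w_def)
    qed
  qed
  interpret weighted_forest G E w by (rule forest)
  have w_sets: "{p \<in> E. w p = g} \<in> sets (M \<Otimes>\<^sub>M M)" if "g \<in> carrier G" for g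
  proof -
    define K where "K h = {x \<in> space M. k x = h}" for h
    have K: "K h \<in> sets M" for h unfolding K_def by (rule k(2))
    \<comment> \<open>Three kinds of edges: inside \<open>S\<close>, along the orientation, against
      it. In the last case weight \<open>g\<close> means that the label at the second entry is the
      inverse of \<open>g\<close>.\<close>
    have "{p \<in> E. w p = g} = (if g = \<one>\<^bsub>G\<^esub> then E \<inter> S else {}) \<union>
        ((E - S) \<inter> Or \<inter> K g \<times> space M) \<union> ((E - S - Or) \<inter> space M \<times> K (inv\<^bsub>G\<^esub> g))"
    proof (intro Set.set_eqI)
      fix p :: "'a \<times> 'a"
      obtain x y where p: "p = (x, y)" by (cases p)
      have inv_eq: "inv\<^bsub>G\<^esub> k y = g \<longleftrightarrow> k y = inv\<^bsub>G\<^esub> g"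
        using that k(1)[of y] by (metis inv_inv)
      have w_eq: "w (x, y) = g \<longleftrightarrow>
          (if (x, y) \<in> S then g = \<one>\<^bsub>G\<^esub> else if (x, y) \<in> Or then k x = g else k y = inv\<^bsub>G\<^esub> g)"
        by (auto simp: w_def inv_eq)
      have "p \<in> E \<Longrightarrow> x \<in> space M \<and> y \<in> space M" using E_facts(3) R_sub p by auto
      then show "p \<in> {p \<in> E. w p = g} \<longleftrightarrow> p \<in> (if g = \<one>\<^bsub>G\<^esub> then E \<inter> S else {}) \<union>
        ((E - S) \<inter> Or \<inter> K g \<times> space M) \<union> ((E - S - Or) \<inter> space M \<times> K (inv\<^bsub>G\<^esub> g))"
        unfolding p by (auto simp: w_eq K_def)
    qed
    then show ?thesis
      using E_facts(1) S(2) Or(1) K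
      by (auto intro!: sets.Un sets.Int sets.Diff pair_measureI)
  qed
  have R_connected: "R \<subseteq> E\<^sup>*" using treeing_connected[OF R(1) E] by auto
  obtain \<theta> where \<theta>: "borel_group_hom M R G \<theta>" "\<And>p. p \<in> R \<Longrightarrow> p \<in> connected_weight (\<theta> p)"
    "\<And>g. {p \<in> R. \<theta> p = g} \<in> sets (M \<Otimes>\<^sub>M M)"
    by (rule forest_cocycle[OF forest countable w_sets R E_facts(3) R_connected]) blast+
  show ?thesis
  proof (rule that[OF \<theta>(1,3)])
    fix p assume "p \<in> S"
    obtain x y where p: "p = (x, y)" by (cases p)
    have "(x, y) \<in> connected_weight \<one>\<^bsub>G\<^esub>"
    proof (rule rtrancl_imp_connected_weight_one[OF _ E'(2)])
      show "(x, y) \<in> E'\<^sup>*" using treeing_connected[OF S(1) E'(1)] \<open>p \<in> S\<close> p by simp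
      show "w q = \<one>\<^bsub>G\<^esub>" if "q \<in> E'" for q using that \<open>E' \<subseteq> S\<close> by (auto simp: w_def)
    qed
    \<comment> \<open>An \<open>E'\<close>-path joining two \<open>S\<close>-related points is an
      \<open>E\<close>-path and therefore stays inside one \<open>R\<close>-class.\<close>
    moreover have "(x, y) \<in> R"
    proof -
      have "(x, y) \<in> E\<^sup>*" using treeing_connected[OF S(1) E'(1)] \<open>p \<in> S\<close> p rtrancl_mono[OF E'(2)] by auto
      moreover have "(x, x) \<in> R" using \<open>p \<in> S\<close> p S(1) R(1) by (auto simp: equiv_def refl_on_def)
      moreover have "trans R" using R(1) by (simp add: equiv_def)
      ultimately show ?thesis
        by (induction rule: rtrancl_induct) (use E_facts(3) in \<open>auto dest: transD\<close>)
    qed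
    ultimately show "\<theta> p = \<one>\<^bsub>G\<^esub>" using \<theta>(2) connected_weight_unique p by blast
  next
    fix x y assume xy: "(x, y) \<in> (E - S) \<inter> Or"
    then have "(x, y) \<in> connected_weight (k x)"
      using connected_weight_edge[of x y] by (auto simp: w_def)
    then show "\<theta> (x, y) = k x" using \<theta>(2)[of "(x, y)"] xy E_facts(3) connected_weight_unique by blast
  qed
qed

lemma labels_of_disjoint_sequence:
  fixes M :: "'a measure" and G :: "('g, 'm) monoid_scheme" and D :: "nat \<Rightarrow> 'a set"
  assumes "group G" and e: "range e \<subseteq> carrier G"
    and D: "\<And>n. D n \<in> sets M" "\<And>m n. m \<noteq> n \<Longrightarrow> D m \<inter> D n = {}"
  obtains k where "\<And>x. k x \<in> carrier G" "\<And>g. {x \<in> space M. k x = g} \<in> sets M"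
    "\<And>n x. x \<in> D n \<Longrightarrow> k x = e n"
proof -
  interpret group G by (rule assms(1))
  define k where "k x = (if \<exists>n. x \<in> D n then e (THE n. x \<in> D n) else \<one>\<^bsub>G\<^esub>)" for x
  have k: "k x = e n" if "x \<in> D n" for x n
  proof -
    have "(THE n. x \<in> D n) = n" using that D(2) by (intro the_equality) blast+
    then show ?thesis using that by (auto simp: k_def)
  qed
  have k_one: "k x = \<one>\<^bsub>G\<^esub>" if "x \<notin> (\<Union>n. D n)" for x using that by (simp add: k_def)
  have "{x \<in> space M. k x = g} \<in> sets M" for g
  proof -
    \<comment> \<open>The enumeration \<open>e\<close> may repeat values, so a level set can consist
      of several \<open>D n\<close>; the default value \<open>\<one>\<close> adds the measurable
      remainder.\<close>
    have "{x \<in> space M. k x = g} = (\<Union>n\<in>{n. e n = g}. D n) \<union> (if g = \<one>\<^bsub>G\<^esub> then space M - (\<Union>n. D n) else {})"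
      (is "?L = ?R")
    proof (intro Set.set_eqI)
      fix x
      show "x \<in> ?L \<longleftrightarrow> x \<in> ?R"
      proof (cases "x \<in> (\<Union>n. D n)")
        case True
        then obtain n where n: "x \<in> D n" by blast
        moreover have "x \<in> D m \<longleftrightarrow> m = n" for m using n D(2) by blast
        moreover have "x \<in> space M" using n sets.sets_into_space[OF D(1)] by blast
        ultimately show ?thesis using k[OF n] by auto
      qed (auto simp: k_one)
    qed
    then show ?thesis using D(1) by auto
  qed
  moreover have "k x \<in> carrier G" for x using e by (auto simp: k_def)
  ultimately show ?thesis using that k by blast
qed

theorem theorem1p2:
  fixes M :: "'a measure" and R :: "'a rel" and G :: "('g, 'm) monoid_scheme"
  assumes "prob_space M" and "standard_borel M"
    and "borel_equiv M R" and "discrete_rel M R" and "pmp M R" and "ergodic_rel M R"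
    and "treeable M R" and "cost M R > 1"
    and "\<exists>S. ergodic_rel M S \<and> primitive_subrel M S R \<and> proper_subrel M S R"
    and "group G" and "countable (carrier G)"
  shows "\<exists>N. ergodic_rel M N \<and> normal_subrel M N R \<and>
             (\<exists>Q :: 'g monoid. is_quotient M R N Q \<and> Q \<cong> G)"
proof -
  obtain T where "polish_measurable_space M T" using standard_borel_polish[OF assms(2)] .
  then interpret polish_prob_space M T
    by (simp add: polish_prob_space_def assms(1))
  interpret G: group G by (rule assms(10))
  have R: "equiv (space M) R" "R \<in> sets (M \<Otimes>\<^sub>M M)" using assms(3) by (simp_all add: borel_equiv_def)
  then have R_sub: "R \<subseteq> space M \<times> space M" and "sym R" "trans R" by (simp_all add: equiv_def)
  obtain S E' E where erg: "ergodic_rel M S" and "subrel M S R" and proper: "\<not> rel_eq_ae M S R"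
    and E': "treeing M S E'" "E' \<subseteq> E" and E: "treeing M R E"
    using assms(9) unfolding primitive_subrel_def proper_subrel_def by blast
  then have S: "equiv (space M) S" "S \<in> sets (M \<Otimes>\<^sub>M M)" "S \<subseteq> R"
    by (simp_all add: subrel_def borel_equiv_def)
  have "sym S" "trans S" "refl_on (space M) S" using S(1) by (simp_all add: equiv_def)
  have E_facts: "E \<in> sets (M \<Otimes>\<^sub>M M)" "E \<subseteq> R" using E by (simp_all add: treeing_def graphing_def)
  have "(S - R) \<union> (R - S) = R - S" using S(3) by blast
  then have "mu_L M (R - S) \<noteq> 0" using proper by (simp add: rel_eq_ae_def)
  then obtain B where B: "B \<in> sets M" "emeasure M B \<noteq> 0" "\<And>x. x \<in> B \<Longrightarrow> \<exists>y. (x, y) \<in> R - S"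
    using mu_L_nonzero_imp_set by metis
  have points: "emeasure M {p} = 0" if "p \<in> space M" for p
  proof (rule nonatomic_of_proper[OF R_sub assms(5) S(1) erg _ B that])
    show "countable (S `` {x})" if "x \<in> space M" for x
      using assms(4) that S(3) countable_subset[of "S `` {x}" "R `` {x}"]
      by (auto simp: discrete_rel_def)
  qed
  \<comment> \<open>Along an \<open>E\<close>-path from \<open>x\<close>, either every step lies in
    \<open>S\<close>, or the first step outside \<open>S\<close> starts at a point that is still
    \<open>S\<close>-related to \<open>x\<close>.\<close>
  have escape: "(x, y) \<in> S \<or> (\<exists>u\<in>Domain (E - S). (x, u) \<in> S)" if "x \<in> space M" "(x, y) \<in> E\<^sup>*" for x y
    using that(2)
  proof (induction rule: rtrancl_induct)
    case base
    then show ?case using \<open>refl_on (space M) S\<close> that(1) by (simp add: refl_on_def)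
  next
    case (step y z)
    then show ?case using \<open>trans S\<close> by (cases "(y, z) \<in> S") (auto dest: transD)
  qed
  have B_sub: "B \<subseteq> {x. \<exists>u\<in>Domain (E - S). (x, u) \<in> S}"
  proof
    fix x assume "x \<in> B"
    then obtain y where "(x, y) \<in> R" "(x, y) \<notin> S" using B(3) by blast
    then show "x \<in> {x. \<exists>u\<in>Domain (E - S). (x, u) \<in> S}"
      using escape treeing_connected[OF R(1) E] R_sub by blast
  qed
  have F: "E - S \<in> sets (M \<Otimes>\<^sub>M M)" "E - S \<subseteq> space M \<times> space M" "\<And>x. (x, x) \<notin> E - S"
    using E_facts S(2) R_sub treeing_imp_no_cycle(1)[OF R(1) E] by auto
  obtain Or A where Or: "Or \<in> sets (M \<Otimes>\<^sub>M M)" "\<And>x y. (x, y) \<in> Or \<Longrightarrow> (y, x) \<notin> Or"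
      "\<And>x y. x \<in> space M \<Longrightarrow> y \<in> space M \<Longrightarrow> x \<noteq> y \<Longrightarrow> (x, y) \<in> Or \<or> (y, x) \<in> Or"
    and A: "A \<in> sets M" "emeasure M A \<noteq> 0" "A \<subseteq> Domain ((E - S) \<inter> Or)"
    by (rule oriented_edges_positive[OF assms(5) S(3,2) F B(1,2) B_sub]) blast
  obtain D :: "nat \<Rightarrow> 'a set" where D: "\<And>n. D n \<in> sets M" "\<And>n. D n \<subseteq> A" "\<And>n. emeasure M (D n) \<noteq> 0"
    "\<And>m n. m \<noteq> n \<Longrightarrow> D m \<inter> D n = {}"
    using nonatomic_disjoint_sequence[OF points A(1,2)] by metis
  \<comment> \<open>An enumeration with repetitions when the group is finite, so that one infinite
    sequence \<open>D\<close> serves every countable group.\<close>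
  define e where "e = from_nat_into (carrier G)"
  have e: "range e = carrier G"
    unfolding e_def using range_from_nat_into[OF _ assms(11)] G.one_closed by blast
  obtain k where k: "\<And>x. k x \<in> carrier G" "\<And>g. {x \<in> space M. k x = g} \<in> sets M"
    "\<And>n x. x \<in> D n \<Longrightarrow> k x = e n"
    using labels_of_disjoint_sequence[of G e D, OF assms(10) _ D(1,4)] e by (metis order_refl)
  obtain \<theta> where \<theta>: "borel_group_hom M R G \<theta>" "\<And>g. {p \<in> R. \<theta> p = g} \<in> sets (M \<Otimes>\<^sub>M M)"
    "\<And>p. p \<in> S \<Longrightarrow> \<theta> p = \<one>\<^bsub>G\<^esub>" "\<And>x y. (x, y) \<in> (E - S) \<inter> Or \<Longrightarrow> \<theta> (x, y) = k x"
    using cocycle_of_oriented_edges[OF assms(10,11) R E S(1,2) E' Or k(1,2)] by blast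
  have \<theta>_closed: "\<theta> p \<in> carrier G" if "p \<in> R" for p
    by (rule borel_group_hom_closed[OF \<theta>(1) R(2) that])
  have hom: "\<theta> (x, y) \<otimes>\<^bsub>G\<^esub> \<theta> (y, z) = \<theta> (x, z)" if "(x, y) \<in> R" "(y, z) \<in> R" for x y z
    using \<theta>(1) that by (simp add: borel_group_hom_def)
  define N where "N = {p \<in> R. \<theta> p = \<one>\<^bsub>G\<^esub>}"
  have "S \<subseteq> N" using S(3) \<theta>(3) by (auto simp: N_def)
  have N: "equiv (space M) N"
  proof (rule equivI)
    show "N \<subseteq> space M \<times> space M" using R_sub by (auto simp: N_def)
    show "refl_on (space M) N"
      using \<open>S \<subseteq> N\<close> \<open>refl_on (space M) S\<close> by (auto simp: refl_on_def)
    show "sym N"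
    proof (rule symI)
      fix x y assume "(x, y) \<in> N"
      then have xy: "(x, y) \<in> R" "\<theta> (x, y) = \<one>\<^bsub>G\<^esub>" by (auto simp: N_def)
      have yx: "(y, x) \<in> R" using xy(1) \<open>sym R\<close> by (simp add: symD)
      have "(x, x) \<in> S" using xy(1) R_sub \<open>refl_on (space M) S\<close> by (auto simp: refl_on_def)
      then have "\<theta> (y, x) = \<one>\<^bsub>G\<^esub>" using hom[OF xy(1) yx] \<theta>(3) xy(2) \<theta>_closed[OF yx] by simp
      then show "(y, x) \<in> N" using yx by (simp add: N_def)
    qed
    show "trans N"
    proof (rule transI)
      fix x y z assume "(x, y) \<in> N" "(y, z) \<in> N"
      then have "(x, y) \<in> R" "(y, z) \<in> R" "\<theta> (x, y) = \<one>\<^bsub>G\<^esub>" "\<theta> (y, z) = \<one>\<^bsub>G\<^esub>" by (auto simp: N_def)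
      then show "(x, z) \<in> N" using hom[of x y z] \<open>trans R\<close> by (auto simp: N_def dest: transD)
    qed
  qed
  have sub: "subrel M N R" using N \<theta>(2) by (auto simp: subrel_def borel_equiv_def N_def)
  have "AE x in M. \<forall>n. \<exists>y\<in>D n. (x, y) \<in> S"
    unfolding AE_all_countable by (intro allI ergodic_saturation_AE[OF S(1,2) erg] D)
  \<comment> \<open>The quotient condition reads weights towards \<open>x\<close>. With
    \<open>y\<close> in \<open>D n\<close> and \<open>S\<close>-related to \<open>x\<close>, and an
    edge from \<open>y\<close> to \<open>v\<close> of weight \<open>e n\<close>, the cocycle
    identity gives \<open>\<theta> (v, x)\<close> as the inverse of \<open>e n\<close>; so the
    \<open>n\<close> chosen labels its set by the inverse of \<open>h\<close>.\<close>
  then have onto: "AE x in M. \<forall>h\<in>carrier G. \<exists>v\<in>R `` {x}. \<theta> (v, x) = h"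
  proof (elim eventually_mono, intro ballI)
    fix x h assume x: "\<forall>n. \<exists>y\<in>D n. (x, y) \<in> S" and h: "h \<in> carrier G"
    have "inv\<^bsub>G\<^esub> h \<in> range e" using e h by simp
    then obtain n where n: "e n = inv\<^bsub>G\<^esub> h" by (metis imageE)
    obtain y where y: "y \<in> D n" "(x, y) \<in> S" using x by blast
    then obtain v where v: "(y, v) \<in> (E - S) \<inter> Or" using D(2) A(3) by blast
    have "(y, x) \<in> S" using y(2) \<open>sym S\<close> by (simp add: symD)
    have yv: "(y, v) \<in> R" "\<theta> (y, v) = inv\<^bsub>G\<^esub> h"
      using v E_facts(2) \<theta>(4)[OF v] k(3)[OF y(1)] n by auto
    have xv: "(x, v) \<in> R" using y(2) S(3) yv(1) \<open>trans R\<close> by (auto dest: transD)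
    then have vx: "(v, x) \<in> R" using \<open>sym R\<close> by (simp add: symD)
    have "inv\<^bsub>G\<^esub> h \<otimes>\<^bsub>G\<^esub> \<theta> (v, x) = \<one>\<^bsub>G\<^esub>"
      using hom[OF yv(1) vx] yv(2) \<theta>(3)[OF \<open>(y, x) \<in> S\<close>] by simp
    then have "\<theta> (v, x) = h"
      using h \<theta>_closed[OF vx] by (metis G.inv_closed G.inv_comm G.inv_equality G.inv_inv)
    then show "\<exists>v\<in>R `` {x}. \<theta> (v, x) = h" using xv by blast
  qed
  \<comment> \<open>A copy of \<open>G\<close> stripped of possible extra record fields, to match
    the type \<open>'g monoid\<close> in the conclusion.\<close>
  define Q :: "'g monoid" where "Q = \<lparr>carrier = carrier G, monoid.mult = mult G, one = one G\<rparr>"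
  have [simp]: "carrier Q = carrier G" "mult Q = mult G" "one Q = one G" by (simp_all add: Q_def)
  have "group Q"
    by (rule groupI) (use G.l_inv_ex in \<open>auto simp: G.m_assoc\<close>)
  have "id \<in> iso Q G" by (simp add: iso_def hom_def bij_betw_def)
  then have "Q \<cong> G" by (auto simp: is_iso_def)
  have "borel_group_hom M R Q \<theta>" using \<theta>(1) by (simp add: borel_group_hom_def)
  moreover have "{p \<in> R. \<theta> p = one Q} = N" by (simp add: N_def)
  then have "rel_eq_ae M {p \<in> R. \<theta> p = one Q} N" by (simp add: rel_eq_ae_def mu_L_def)
  ultimately have "is_quotient M R N Q"
    unfolding is_quotient_def using \<open>group Q\<close> assms(11) onto by auto
  moreover have "normal_subrel M N R"
    using kernel_normal_subrel[OF assms(10,11) \<theta>(1) R N_def sub] .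
  moreover have "ergodic_rel M N" using ergodic_rel_mono[OF erg \<open>S \<subseteq> N\<close> S(1) N] .
  ultimately show ?thesis using \<open>Q \<cong> G\<close> by blast
qed

end
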